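(* Suppose $\mathcal{L}_1,\ldots,\mathcal{L}_k\in\mathrm{Mat}_d(\mathbb{R})$ are simultaneously diagonalisable over $\mathbb{C}$ into the diagonal matrices $\mathcal{D}_1,\ldots,\mathcal{D}_k$, where $\mathcal{D}_l=\mathrm{diag}(\lambda_{l1},\ldots,\lambda_{ld})$ with each $\lambda_{li}\in\mathbb{C}$. Then, for any compact $A\subset\mathbb{R}^d$, $$\mu(\mathcal{L}_1A+\mathcal{L}_2A+\cdots+\mathcal{L}_kA)\geq\left(\prod_{i=1}^d\sum_{l=1}^k|\lambda_{li}|\right)\mu(A).$$ Moreover, equality holds for some compact $A\subset\mathbb{R}^d$ with $\mu(A)>0$.
   Context: $\mu$ is Lebesgue measure on $\mathbb{R}^d$ and $\mathcal{L}_1A+\cdots+\mathcal{L}_kA:=\{\mathcal{L}_1a_1+\cdots+\mathcal{L}_ka_k:a_1,\ldots,a_k\in A\}$. Simultaneously diagonalisable over $\mathbb{C}$ into $\mathcal{D}_1,\ldots,\mathcal{D}_k$ means that there is a single $S\in\mathrm{GL}_d(\mathbb{C})$ with $S^{-1}\mathcal{L}_lS=\mathcal{D}_l$ for all $l$. *)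

theory Defs
  imports "HOL-Analysis.Analysis"
begin

definition diag_matrix :: "('d \<Rightarrow> 'a::zero) \<Rightarrow> 'a ^ 'd ^ 'd"
  where "diag_matrix v = (\<chi> i j. if i = j then v i else 0)"

text \<open>The matrices are \<open>L 1, \<dots>, L k\<close> and the diagonal entries of the
  \<open>l\<close>-th diagonal matrix are \<open>lam l i\<close>; values of \<open>L\<close> and \<open>lam\<close> at
  indices outside \<open>{1..k}\<close> are irrelevant.\<close>

definition simultaneously_diagonalisable_into ::
  "nat \<Rightarrow> (nat \<Rightarrow> real ^ 'd ^ 'd) \<Rightarrow> (nat \<Rightarrow> 'd::finite \<Rightarrow> complex) \<Rightarrow> bool"
  where "simultaneously_diagonalisable_into k L lam \<longleftrightarrow>
    (\<exists>S :: complex ^ 'd ^ 'd. invertible S \<and>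
      (\<forall>l\<in>{1..k}. matrix_inv S ** map_matrix complex_of_real (L l) ** S = diag_matrix (lam l)))"

definition linear_sumset ::
  "nat \<Rightarrow> (nat \<Rightarrow> real ^ 'd ^ 'd) \<Rightarrow> (real ^ 'd) set \<Rightarrow> (real ^ 'd::finite) set"
  where "linear_sumset k L A =
    {(\<Sum>l = 1..k. L l *v a l) | a. \<forall>l\<in>{1..k}. a l \<in> A}"

end

theory Submission
  imports Defs
begin

text \<open>
  Writing \<open>\<phi>(x, y) = S\<^sup>-\<^sup>1 (x + i y)\<close>, a real-linear isomorphism from two copies of real
  space onto complex space, the set \<open>B = \<phi>(A \<times> A)\<close> has measure proportional to the square of that
  of \<open>A\<close>, and the matrices act on it diagonally. So it is enough to bound the sumset of diagonal
  images of one set \<open>B\<close> in complex space. This goes by induction on the number of coordinates: over a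
  point \<open>\<Sum> D\<^sub>l y\<^sub>l\<close> the fibre contains a sum of dilated plane sets, bounded below by
  Brunn-Minkowski, and a superlevel set of the fibre area contains the corresponding sumset of one
  superlevel set for \<open>B\<close>.

  Equality holds for the real points \<open>A\<close> of the unit polydisc in eigencoordinates. Its sumset \<open>K\<close> lies
  in the polydisc of radii \<open>r\<^sub>i = \<Sum> |\<lambda>\<^sub>l\<^sub>i|\<close>. These radii are compatible with
  complex conjugation, so \<open>P = S diag(1/r) S\<^sup>-\<^sup>1\<close> is a real matrix; it maps \<open>K\<close> into \<open>A\<close>, and the
  inequality applied to \<open>P\<close> alone bounds the measure of \<open>K\<close> from above.
\<close>

section \<open>Linear images and level sets\<close>

text \<open>Evaluate the integral of \<open>1\<^sub>E(x) 1\<^sub>B(y)\<close> after translating first \<open>y\<close> by \<open>- x\<close> and then \<open>x\<close> by \<open>y\<close>.\<close>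

lemma translation_invariant_emeasure_proportional:
  fixes N :: "'a::euclidean_space measure"
  assumes "sigma_finite_measure N" and sets_N [measurable_cong]: "sets N = sets borel"
    and inv: "\<And>a. distr N borel ((+) a) = N"
    and [measurable]: "E \<in> sets borel" "B \<in> sets borel"
  shows "emeasure N E * emeasure lborel B = emeasure N (uminus -` B) * emeasure lborel E"
proof -
  interpret N: sigma_finite_measure N by fact
  interpret P: pair_sigma_finite N "lborel :: 'a measure" ..
  have "emeasure N E * emeasure lborel B
      = (\<integral>\<^sup>+x. (\<integral>\<^sup>+y. indicator E x * indicator B y \<partial>lborel) \<partial>N)"
    by (simp add: nn_integral_cmult nn_integral_multc)
  also have "\<dots> = (\<integral>\<^sup>+x. (\<integral>\<^sup>+y. indicator E x * indicator B (y - x) \<partial>lborel) \<partial>N)"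
  proof (rule nn_integral_cong)
    fix x :: 'a
    have "(\<integral>\<^sup>+y. indicator E x * indicator B y \<partial>(distr lborel borel ((+) (- x)))) =
        (\<integral>\<^sup>+y. indicator E x * indicator B (- x + y) \<partial>lborel)"
      by (subst nn_integral_distr) auto
    then show "(\<integral>\<^sup>+y. indicator E x * indicator B y \<partial>lborel) =
        (\<integral>\<^sup>+y. indicator E x * indicator B (y - x) \<partial>lborel)"
      by (simp add: lborel_distr_plus)
  qed
  also have "\<dots> = (\<integral>\<^sup>+y. (\<integral>\<^sup>+x. indicator E x * indicator B (y - x) \<partial>N) \<partial>lborel)"
    by (rule P.Fubini'[symmetric]) measurable
  also have "\<dots> = (\<integral>\<^sup>+y. (\<integral>\<^sup>+x. indicator E (y + x) * indicator B (- x) \<partial>N) \<partial>lborel)"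
  proof (rule nn_integral_cong)
    fix y :: 'a
    have "(\<integral>\<^sup>+x. indicator E x * indicator B (y - x) \<partial>(distr N borel ((+) y))) =
        (\<integral>\<^sup>+x. indicator E (y + x) * indicator B (- x) \<partial>N)"
      by (subst nn_integral_distr) auto
    then show "(\<integral>\<^sup>+x. indicator E x * indicator B (y - x) \<partial>N) =
        (\<integral>\<^sup>+x. indicator E (y + x) * indicator B (- x) \<partial>N)"
      by (simp add: inv)
  qed
  also have "\<dots> = (\<integral>\<^sup>+x. (\<integral>\<^sup>+y. indicator E (y + x) * indicator B (- x) \<partial>lborel) \<partial>N)"
    by (rule P.Fubini') measurable
  also have "\<dots> = (\<integral>\<^sup>+x. emeasure lborel E * indicator (uminus -` B) x \<partial>N)"
  proof (rule nn_integral_cong)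
    fix x :: 'a
    have "(\<integral>\<^sup>+y. indicator E y * indicator B (- x) \<partial>(distr lborel borel ((+) x))) =
        (\<integral>\<^sup>+y. indicator E (x + y) * indicator B (- x) \<partial>lborel)"
      by (subst nn_integral_distr) auto
    moreover have "indicator (uminus -` B) x = (indicator B (- x) :: ennreal)"
      by (simp add: indicator_def)
    ultimately show "(\<integral>\<^sup>+y. indicator E (y + x) * indicator B (- x) \<partial>lborel) =
        emeasure lborel E * indicator (uminus -` B) x"
      by (simp add: lborel_distr_plus nn_integral_multc add.commute)
  qed
  also have "\<dots> = emeasure N (uminus -` B) * emeasure lborel E"
  proof -
    have "uminus -` B \<in> sets N"
      using measurable_sets[of uminus borel borel B] by (simp add: sets_N)
    then show ?thesis
      by (simp add: nn_integral_cmult mult.commute)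
  qed
  finally show ?thesis .
qed

lemma linear_bij_emeasure_lborel:
  fixes f :: "'a::euclidean_space \<Rightarrow> 'b::euclidean_space"
  assumes "linear f" "bij f"
  obtains c :: real where "c > 0"
    and "\<And>E. E \<in> sets borel \<Longrightarrow> f ` E \<in> sets borel"
    and "\<And>E. E \<in> sets borel \<Longrightarrow> emeasure lborel (f ` E) = ennreal c * emeasure lborel E"
proof -
  define g where "g = inv f"
  have fg: "f (g y) = y" for y
    using assms(2) by (simp add: g_def bij_def surj_f_inv_f)
  have gf: "g (f x) = x" for x
    using assms(2) by (simp add: g_def bij_def inv_f_f)
  have "linear g"
    by (intro linearI; rule injD[of f])
       (use assms fg in \<open>auto simp: bij_def linear_add linear_scale\<close>)
  then have cont: "continuous_on UNIV g" "continuous_on UNIV f"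
    using assms by (auto intro: linear_continuous_on linear_conv_bounded_linear[THEN iffD1])
  then have [measurable]: "g \<in> borel_measurable borel" "f \<in> borel_measurable borel"
    by (auto intro: borel_measurable_continuous_onI)
  have im: "f ` E = g -` E" for E
    using fg gf by (auto simp: image_iff) metis+
  have meas: "f ` E \<in> sets borel" if "E \<in> sets borel" for E
    using measurable_sets[of g borel borel E] that by (simp add: im)
  define N where "N = distr lborel borel g"
  have N: "emeasure N E = emeasure lborel (f ` E)" if "E \<in> sets borel" for E
    using that by (simp add: N_def emeasure_distr im)
  \<comment> \<open>Pushing \<open>N\<close> forward along \<open>f\<close> gives back
    \<open>lborel\<close>, and sigma-finiteness of an image measure passes back to the measure
    itself.\<close>
  have "sigma_finite_measure (distr N borel f)"
    unfolding N_def by (subst distr_distr) (auto simp: o_def fg lborel.sigma_finite_measure_axioms distr_id2)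
  then have sf: "sigma_finite_measure N"
    by (rule sigma_finite_measure_distr) (simp add: N_def)
  have inv: "distr N borel ((+) a) = N" for a
  proof -
    have "distr N borel ((+) a) = distr lborel borel (g \<circ> (+) (f a))"
      unfolding N_def using \<open>linear g\<close>
      by (subst distr_distr) (auto simp: o_def linear_add gf)
    also have "\<dots> = distr (distr lborel borel ((+) (f a))) borel g"
      by (subst distr_distr) auto
    finally show ?thesis
      by (simp add: lborel_distr_plus N_def)
  qed
  \<comment> \<open>The test set is symmetric, which removes the reflection from the
    proportionality, and both it and its image have positive finite measure. The constant will be
    the ratio of these two measures.\<close>
  define B where "B = cball (0::'a) 1"
  have B: "uminus -` B = B" "B \<in> sets borel"
    by (auto simp: B_def)
  have eq: "emeasure lborel (f ` E) * emeasure lborel B = emeasure lborel (f ` B) * emeasure lborel E"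
    if "E \<in> sets borel" for E
  proof -
    have "sets N = sets borel"
      by (simp add: N_def)
    from translation_invariant_emeasure_proportional[OF sf this inv that B(2)] show ?thesis
      unfolding B(1) N[OF that] N[OF B(2)] .
  qed
  have "bounded B" "bounded (f ` B)"
    using bounded_linear_image[of B f] assms(1) linear_conv_bounded_linear by (auto simp: B_def)
  then have fin: "emeasure lborel B < \<infinity>" "emeasure lborel (f ` B) < \<infinity>"
    by (blast intro: emeasure_bounded_finite)+
  have pos: "emeasure lborel S > 0" if "open T" "T \<noteq> {}" "T \<subseteq> S" "S \<in> sets borel" for T S :: "'c::euclidean_space set"
  proof -
    have "emeasure lborel T \<noteq> 0"
      using open_not_negligible[OF that(1,2)] that(1)
      by (simp add: negligible_iff_emeasure0)
    moreover have "emeasure lborel T \<le> emeasure lborel S"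
      using that by (intro emeasure_mono) auto
    ultimately show ?thesis
      by (metis le_zero_eq not_gr_zero)
  qed
  have "open (f ` ball 0 1)"
    unfolding im using cont(1) by (simp add: open_vimage)
  then have "emeasure lborel (f ` B) > 0"
    by (rule pos) (auto simp: B_def intro: meas)
  moreover have "emeasure lborel B > 0"
    by (rule pos[of "ball 0 1"]) (auto simp: B_def)
  ultimately obtain p q where pq: "p > 0" "q > 0" "emeasure lborel B = ennreal p"
      "emeasure lborel (f ` B) = ennreal q"
    using fin by (cases "emeasure lborel B"; cases "emeasure lborel (f ` B)") auto
  show thesis
  proof (rule that[of "q / p"])
    fix E :: "'a set" assume "E \<in> sets borel"
    note eq[OF this]
    then have "emeasure lborel (f ` E) * (ennreal p * ennreal (1 / p))
        = ennreal q * ennreal (1 / p) * emeasure lborel E"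
      by (simp add: pq mult_ac) (metis mult.assoc mult.commute)
    moreover have "ennreal p * ennreal (1 / p) = 1" "ennreal q * ennreal (1 / p) = ennreal (q / p)"
      using pq by (simp_all add: ennreal_mult[symmetric])
    ultimately show "emeasure lborel (f ` E) = ennreal (q / p) * emeasure lborel E"
      by simp
  qed (use pq meas in auto)
qed

text \<open>Layer cake formula: \<open>f x\<close> is the length of the set of levels
  \<open>t \<ge> 0\<close> strictly below it, and Tonelli exchanges the two integrations.\<close>

lemma nn_integral_level_sets:
  assumes "sigma_finite_measure M" and f [measurable]: "f \<in> borel_measurable M"
  shows "(\<integral>\<^sup>+x. f x \<partial>M) =
    (\<integral>\<^sup>+t. indicator {0..} t * emeasure M {x\<in>space M. ennreal t < f x} \<partial>lborel)"
proof -
  interpret M: sigma_finite_measure M by fact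
  interpret P: pair_sigma_finite M "lborel :: real measure" ..
  have len: "emeasure lborel {t. 0 \<le> t \<and> ennreal t < y} = y" for y
  proof (cases y)
    case (real r)
    then have "{t. 0 \<le> t \<and> ennreal t < y} = {0..<r}"
      by (auto simp: ennreal_less_iff)
    then show ?thesis using real by simp
  next
    case top
    then have "{t. 0 \<le> t \<and> ennreal t < y} = {0..}"
      by (auto simp: less_top[symmetric])
    moreover have "emeasure lborel {0::real..} = top"
    proof (rule ccontr)
      assume "emeasure lborel {0::real..} \<noteq> top"
      then obtain r where r: "r \<ge> 0" "emeasure lborel {0::real..} = ennreal r"
        by (cases "emeasure lborel {0::real..}") auto
      have "emeasure lborel {0..r + 1} \<le> emeasure lborel {0::real..}"
        by (intro emeasure_mono) auto
      then show False using r by (simp add: ennreal_le_iff2)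
    qed
    ultimately show ?thesis using top by simp
  qed
  have "(\<integral>\<^sup>+x. f x \<partial>M) = (\<integral>\<^sup>+x. (\<integral>\<^sup>+t. indicator {t. 0 \<le> t \<and> ennreal t < f x} t \<partial>lborel) \<partial>M)"
    by (intro nn_integral_cong) (simp add: len)
  also have "\<dots> = (\<integral>\<^sup>+x. (\<integral>\<^sup>+t. indicator {0..} t * indicator {x\<in>space M. ennreal t < f x} x \<partial>lborel) \<partial>M)"
    by (intro nn_integral_cong) (auto split: split_indicator)
  also have "\<dots> = (\<integral>\<^sup>+t. (\<integral>\<^sup>+x. indicator {0..} t * indicator {x\<in>space M. ennreal t < f x} x \<partial>M) \<partial>lborel)"
    by (rule P.Fubini'[symmetric]) measurable
  also have "\<dots> = (\<integral>\<^sup>+t. indicator {0..} t * emeasure M {x\<in>space M. ennreal t < f x} \<partial>lborel)"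
    by (simp add: nn_integral_cmult)
  finally show ?thesis .
qed

section \<open>The Brunn-Minkowski inequality in the plane\<close>

lemma emeasure_lborel_vimage_plus:
  fixes S :: "'a::euclidean_space set"
  assumes "S \<in> sets borel"
  shows "emeasure lborel ((+) c -` S) = emeasure lborel S"
proof -
  have "emeasure (distr lborel borel ((+) c)) S = emeasure lborel ((+) c -` S)"
    using assms by (simp add: emeasure_distr)
  then show ?thesis by (simp add: lborel_distr_plus)
qed

text \<open>For \<open>a \<in> A\<close> near the supremum and \<open>b \<in> B\<close> near the infimum, the translates of
  \<open>A \<inter> {..a}\<close> by \<open>b\<close> and of \<open>B \<inter> {b<..}\<close> by \<open>a\<close> are separated by the point \<open>a + b\<close>.\<close>

lemma emeasure_real_sumset_ge:
  fixes A B E :: "real set"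
  assumes [measurable]: "A \<in> sets borel" "B \<in> sets borel" "E \<in> sets borel"
    and bd: "bounded A" "bounded B" and ne: "A \<noteq> {}" "B \<noteq> {}"
    and sum: "\<And>x y. x \<in> A \<Longrightarrow> y \<in> B \<Longrightarrow> x + y \<in> E"
  shows "emeasure lborel A + emeasure lborel B \<le> emeasure lborel E"
proof (rule ennreal_le_epsilon)
  fix e :: real assume "e > 0"
  have bdd: "bdd_above A" "bdd_below B"
    using bd by (auto intro: bounded_imp_bdd_above bounded_imp_bdd_below)
  obtain a where a: "a \<in> A" "Sup A - e / 2 < a"
    using less_cSup_iff[OF ne(1) bdd(1), of "Sup A - e / 2"] \<open>e > 0\<close> by auto
  obtain b where b: "b \<in> B" "b < Inf B + e / 2"
    using cInf_less_iff[OF ne(2) bdd(2), of "Inf B + e / 2"] \<open>e > 0\<close> by auto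
  have aS: "a \<le> Sup A" and bI: "Inf B \<le> b"
    using a b bdd by (auto intro: cSup_upper cInf_lower)
  define P where "P = (+) (-b) -` (A \<inter> {..a})"
  define Q where "Q = (+) (-a) -` (B \<inter> {b<..})"
  have [measurable]: "P \<in> sets borel" "Q \<in> sets borel"
    unfolding P_def Q_def using measurable_sets[of "(+) _" borel borel] by auto
  have PQ: "emeasure lborel P = emeasure lborel (A \<inter> {..a})"
      "emeasure lborel Q = emeasure lborel (B \<inter> {b<..})"
    unfolding P_def Q_def by (auto intro!: emeasure_lborel_vimage_plus simp del: vimage_Int)
  \<comment> \<open>Truncating \<open>A\<close> at \<open>a\<close> loses only points between
    \<open>a\<close> and \<open>Sup A\<close>, an interval shorter than \<open>e / 2\<close>; the
    same happens to \<open>B\<close> at its lower end.\<close>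
  have "emeasure lborel A \<le> emeasure lborel ((A \<inter> {..a}) \<union> {a..Sup A})"
    using bdd by (intro emeasure_mono) (auto intro: cSup_upper)
  also have "\<dots> \<le> emeasure lborel (A \<inter> {..a}) + emeasure lborel {a..Sup A}"
    by (rule emeasure_subadditive) auto
  also have "\<dots> \<le> emeasure lborel P + ennreal (e / 2)"
    using a aS by (auto simp: PQ intro!: add_mono ennreal_leI)
  finally have 1: "emeasure lborel A \<le> emeasure lborel P + ennreal (e / 2)" .
  have "emeasure lborel B \<le> emeasure lborel ((B \<inter> {b<..}) \<union> {Inf B..b})"
    using bdd by (intro emeasure_mono) (auto intro: cInf_lower)
  also have "\<dots> \<le> emeasure lborel (B \<inter> {b<..}) + emeasure lborel {Inf B..b}"
    by (rule emeasure_subadditive) auto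
  also have "\<dots> \<le> emeasure lborel Q + ennreal (e / 2)"
    using b bI by (auto simp: PQ intro!: add_mono ennreal_leI)
  finally have 2: "emeasure lborel B \<le> emeasure lborel Q + ennreal (e / 2)" .
  have "emeasure lborel P + emeasure lborel Q = emeasure lborel (P \<union> Q)"
    by (intro plus_emeasure) (auto simp: P_def Q_def)
  also have "\<dots> \<le> emeasure lborel E"
  proof (intro emeasure_mono)
    show "P \<union> Q \<subseteq> E"
    proof
      fix z assume "z \<in> P \<union> Q"
      then consider "z - b \<in> A" | "z - a \<in> B"
        by (auto simp: P_def Q_def)
      then show "z \<in> E"
        using sum[of "z - b" b] sum[of a "z - a"] a b by cases auto
    qed
  qed auto
  finally have 3: "emeasure lborel P + emeasure lborel Q \<le> emeasure lborel E" .
  have "emeasure lborel A + emeasure lborel B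
      \<le> (emeasure lborel P + emeasure lborel Q) + (ennreal (e / 2) + ennreal (e / 2))"
    using add_mono[OF 1 2] by (simp add: add_ac)
  also have "\<dots> \<le> emeasure lborel E + ennreal e"
    using 3 \<open>e > 0\<close> by (simp add: ennreal_plus[symmetric] add_mono del: ennreal_plus)
  finally show "emeasure lborel A + emeasure lborel B \<le> emeasure lborel E + ennreal e" .
qed

text \<open>The difference of the two sides is the square
  \<open>(b * sqrt p - a * sqrt q)\<^sup>2\<close> divided by \<open>a * b\<close>. This removes the
  auxiliary weights \<open>a\<close> and \<open>b\<close> at the end of the planar Brunn-Minkowski
  proof.\<close>

lemma sqrt_sum_power2_le:
  fixes a b p q :: real
  assumes "a > 0" "b > 0" "p \<ge> 0" "q \<ge> 0"
  shows "(sqrt p + sqrt q)\<^sup>2 \<le> (a + b) * (p / a + q / b)"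
proof -
  have "0 \<le> (b * sqrt p - a * sqrt q)\<^sup>2 / (a * b)"
    using assms by simp
  also have "\<dots> = (a + b) * (p / a + q / b) - (sqrt p + sqrt q)\<^sup>2"
    using assms by (simp add: field_simps power2_eq_square)
  finally show ?thesis by simp
qed

text \<open>Rescaling by the suprema \<open>a\<close>, \<open>b\<close> of the fibre lengths makes the superlevel sets of \<open>A\<close> and \<open>B\<close>
  nonempty for the same range of levels, so the one-dimensional bound applies at every level.\<close>

lemma brunn_minkowski_real_prod:
  fixes A B E :: "(real \<times> real) set"
  assumes meas: "A \<in> sets borel" "B \<in> sets borel" "E \<in> sets borel"
    and bd: "bounded A" "bounded B" and fin: "emeasure lborel E < \<infinity>"
    and pos: "measure lborel A > 0" "measure lborel B > 0"
    and sum: "\<And>x y. x \<in> A \<Longrightarrow> y \<in> B \<Longrightarrow> x + y \<in> E"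
  shows "sqrt (measure lborel A) + sqrt (measure lborel B) \<le> sqrt (measure lborel E)"
proof -
  define len where "len S x = emeasure lborel (Pair x -` S)" for S :: "(real \<times> real) set" and x
  have sl: "Pair x -` S \<in> sets borel" if "S \<in> sets borel" for S :: "(real \<times> real) set" and x
  proof -
    have "S \<in> sets (borel \<Otimes>\<^sub>M borel)"
      unfolding borel_prod by (rule that)
    then show ?thesis by (rule sets_Pair1)
  qed
  have len_meas [measurable]: "len S \<in> borel_measurable borel" if "S \<in> sets borel" for S
    using that lborel.measurable_emeasure_Pair[of S borel]
    by (simp add: len_def[abs_def] borel_prod cong: sets_pair_measure_cong)
  have int: "emeasure lborel S = (\<integral>\<^sup>+x. len S x \<partial>lborel)" if "S \<in> sets borel" for S
  proof -
    have "emeasure (lborel \<Otimes>\<^sub>M lborel) S = (\<integral>\<^sup>+x. len S x \<partial>lborel)"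
      unfolding len_def by (rule lborel.emeasure_pair_measure_alt) (simp only: lborel_prod sets_lborel that)
    then show ?thesis by (simp add: lborel_prod)
  qed
  have bsl: "bounded (Pair x -` S)" if "bounded S" for S :: "(real \<times> real) set" and x
    using bounded_snd[OF that] by (rule bounded_subset) force
  \<comment> \<open>Finite because \<open>S\<close> lies in a horizontal strip of bounded height,
    nonzero because a set all of whose fibres are null is null.\<close>
  have sup: "\<exists>a>0. (SUP x. len S x) = ennreal a"
    if S: "S \<in> sets borel" "bounded S" "measure lborel S > 0" for S
  proof -
    obtain r where r: "\<And>z. z \<in> S \<Longrightarrow> norm z \<le> r" "r > 0"
      using \<open>bounded S\<close> by (auto simp: bounded_pos)
    have "len S x \<le> emeasure lborel {-r..r}" for x
      unfolding len_def
    proof (intro emeasure_mono)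
      show "Pair x -` S \<subseteq> {-r..r}"
      proof
        fix y assume "y \<in> Pair x -` S"
        then have "norm (x, y) \<le> r" using r by auto
        then have "\<bar>y\<bar> \<le> r" using norm_snd_le[of y x] by simp
        then show "y \<in> {-r..r}" by auto
      qed
    qed auto
    then have "(SUP x. len S x) \<le> ennreal (2 * r)"
      using r by (intro SUP_least) (simp add: emeasure_lborel_Icc_eq)
    moreover have "(SUP x. len S x) \<noteq> 0"
    proof
      assume "(SUP x. len S x) = 0"
      then have "len S x = 0" for x
        by (metis SUP_upper UNIV_I le_zero_eq)
      then have "emeasure lborel S = 0" using int[OF S(1)] by simp
      then show False using S(3) by (simp add: measure_def)
    qed
    ultimately show ?thesis
      by (cases "SUP x. len S x") (auto simp: top_unique le_less)
  qed
  obtain a where a: "a > 0" "(SUP x. len A x) = ennreal a"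
    using sup[OF meas(1) bd(1) pos(1)] by auto
  obtain b where b: "b > 0" "(SUP x. len B x) = ennreal b"
    using sup[OF meas(2) bd(2) pos(2)] by auto
  have level: "emeasure lborel {x. ennreal t < ennreal (1/a) * len A x} +
      emeasure lborel {x. ennreal t < ennreal (1/b) * len B x}
    \<le> emeasure lborel {x. ennreal t < ennreal (1/(a+b)) * len E x}" (is "?L \<le> ?R")
    if "t \<ge> 0" for t
  proof -
    have lev: "ennreal t < ennreal (1/c) * y \<longleftrightarrow> ennreal (t * c) < y" if "c > 0" for y and c :: real
    proof (cases y)
      case (real r)
      then show ?thesis using that \<open>t \<ge> 0\<close>
        by (simp add: ennreal_mult[symmetric] ennreal_less_iff field_simps)
    next
      case top
      then show ?thesis using that by (simp add: ennreal_mult_top)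
    qed
    let ?A = "{x. ennreal (t * a) < len A x}" and ?B = "{x. ennreal (t * b) < len B x}"
      and ?E = "{x. ennreal (t * (a + b)) < len E x}"
    \<comment> \<open>After rescaling, both suprema are 1: for \<open>t < 1\<close> both level sets
      are nonempty, and for \<open>t \<ge> 1\<close> both are empty.\<close>
    have "emeasure lborel ?A + emeasure lborel ?B \<le> emeasure lborel ?E"
    proof (cases "t < 1")
      case True
      then have "ennreal (t * a) < (SUP x. len A x)" "ennreal (t * b) < (SUP x. len B x)"
        using a b \<open>t \<ge> 0\<close> by (auto simp: ennreal_less_iff)
      then have ne: "?A \<noteq> {}" "?B \<noteq> {}"
        by (auto simp: less_SUP_iff)
      have bounded_level: "bounded {x. ennreal s < len S x}" if "bounded S" for s S
      proof (rule bounded_subset[OF bounded_fst[OF that]])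
        show "{x. ennreal s < len S x} \<subseteq> fst ` S"
        proof
          fix x assume "x \<in> {x. ennreal s < len S x}"
          then have "Pair x -` S \<noteq> {}" by (auto simp: len_def)
          then show "x \<in> fst ` S" by force
        qed
      qed
      show ?thesis
      proof (rule emeasure_real_sumset_ge)
        fix x y assume x: "x \<in> ?A" and y: "y \<in> ?B"
        \<comment> \<open>The one-dimensional bound is used twice: outside for level sets on the
          base, here for the fibres over \<open>x\<close> and \<open>y\<close>, whose sums lie in
          the fibre of \<open>E\<close> over \<open>x + y\<close>.\<close>
        have "len A x + len B y \<le> len E (x + y)"
          unfolding len_def
        proof (rule emeasure_real_sumset_ge)
          show "Pair x -` A \<noteq> {}" "Pair y -` B \<noteq> {}"
            using x y by (auto simp: len_def)
          show "u + v \<in> Pair (x + y) -` E" if "u \<in> Pair x -` A" "v \<in> Pair y -` B" for u v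
            using sum[of "(x, u)" "(y, v)"] that by simp
        qed (use meas bd in \<open>auto intro: sl bsl\<close>)
        moreover have "ennreal (t * (a + b)) = ennreal (t * a) + ennreal (t * b)"
          using a b \<open>t \<ge> 0\<close> by (simp add: ennreal_plus[symmetric] algebra_simps del: ennreal_plus)
        ultimately show "x + y \<in> ?E"
          using x y by (auto intro: less_le_trans[OF add_strict_mono])
      qed (use meas bd ne bounded_level in auto)
    next
      case False
      then have ge: "ennreal a \<le> ennreal (t * a)" "ennreal b \<le> ennreal (t * b)"
        using a b by (auto intro: ennreal_leI)
      have "len A x \<le> ennreal (t * a)" "len B x \<le> ennreal (t * b)" for x
        using SUP_upper[of x UNIV "len A"] SUP_upper[of x UNIV "len B"] ge unfolding a(2) b(2)
        by (blast intro: order_trans)+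
      then have "?A = {}" "?B = {}" by (auto simp: not_less)
      then show ?thesis by simp
    qed
    then show ?thesis using a b by (simp add: lev)
  qed
  let ?F = "\<lambda>S c t. indicator {0..} t * emeasure lborel {x. ennreal t < ennreal (1/c) * len S x}"
  have lc: "ennreal (1/c) * emeasure lborel S = (\<integral>\<^sup>+t. ?F S c t \<partial>lborel)"
    if [measurable]: "S \<in> sets borel" for S and c :: real
  proof -
    have "(\<integral>\<^sup>+x. ennreal (1/c) * len S x \<partial>lborel) = ennreal (1/c) * emeasure lborel S"
      unfolding int[OF that] by (rule nn_integral_cmult) measurable
    moreover have "(\<integral>\<^sup>+x. ennreal (1/c) * len S x \<partial>lborel) = (\<integral>\<^sup>+t. ?F S c t \<partial>lborel)"
      by (subst nn_integral_level_sets) (auto simp: lborel.sigma_finite_measure_axioms)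
    ultimately show ?thesis by simp
  qed
  have F_meas: "?F S c \<in> borel_measurable borel" if [measurable]: "S \<in> sets borel" for S and c :: real
  proof -
    have "(\<lambda>t::real. emeasure lborel {x \<in> space lborel. ennreal t < ennreal (1/c) * len S x})
        \<in> borel_measurable borel"
      by (rule lborel.measurable_emeasure) measurable
    then show ?thesis by simp
  qed
  have "ennreal (1/a) * emeasure lborel A + ennreal (1/b) * emeasure lborel B
      = (\<integral>\<^sup>+t. ?F A a t + ?F B b t \<partial>lborel)"
    unfolding lc[OF meas(1)] lc[OF meas(2)]
    using meas by (intro nn_integral_add[symmetric]) (simp_all add: F_meas)
  also have "\<dots> \<le> (\<integral>\<^sup>+t. ?F E (a + b) t \<partial>lborel)"
    using level by (intro nn_integral_mono) (auto simp: indicator_def)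
  also have "\<dots> = ennreal (1/(a + b)) * emeasure lborel E"
    unfolding lc[OF meas(3)] ..
  finally have main: "ennreal (1/a) * emeasure lborel A + ennreal (1/b) * emeasure lborel B
    \<le> ennreal (1/(a + b)) * emeasure lborel E" .
  have "emeasure lborel A = ennreal (measure lborel A)" "emeasure lborel B = ennreal (measure lborel B)"
    "emeasure lborel E = ennreal (measure lborel E)"
    using emeasure_bounded_finite[OF bd(1)] emeasure_bounded_finite[OF bd(2)] fin
    by (auto intro: emeasure_eq_ennreal_measure)
  with main have "measure lborel A / a + measure lborel B / b \<le> measure lborel E / (a + b)"
    using a b by (simp add: ennreal_mult[symmetric] ennreal_plus[symmetric] del: ennreal_plus)
  then have "(a + b) * (measure lborel A / a + measure lborel B / b) \<le> measure lborel E"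
    using a b by (simp add: pos_le_divide_eq mult.commute)
  then have "(sqrt (measure lborel A) + sqrt (measure lborel B))\<^sup>2 \<le> measure lborel E"
    using sqrt_sum_power2_le[of a b "measure lborel A" "measure lborel B"] a b by simp
  then show ?thesis
    by (rule real_le_rsqrt)
qed

section \<open>Brunn-Minkowski for finite sums in the complex plane\<close>

lemma bij_Complex: "bij (\<lambda>(x, y). Complex x y)"
  by (rule bij_betw_byWitness[where f' = "\<lambda>z. (Re z, Im z)"]) auto

lemma linear_Complex: "linear (\<lambda>(x, y). Complex x y)"
  by (rule linearI) (auto simp: complex_eq_iff)

lemma measure_eq_scale:
  assumes "c \<ge> 0" "emeasure M X = ennreal c * emeasure N Y"
  shows "measure M X = c * measure N Y"
  using assms by (simp add: measure_def enn2real_mult)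

lemma brunn_minkowski_complex:
  fixes A B E :: "complex set"
  assumes meas: "A \<in> sets borel" "B \<in> sets borel" "E \<in> sets borel"
    and bd: "bounded A" "bounded B" and fin: "emeasure lborel E < \<infinity>"
    and ne: "A \<noteq> {}" "B \<noteq> {}"
    and sum: "\<And>x y. x \<in> A \<Longrightarrow> y \<in> B \<Longrightarrow> x + y \<in> E"
  shows "sqrt (measure lborel A) + sqrt (measure lborel B) \<le> sqrt (measure lborel E)"
proof -
  \<comment> \<open>For the case that \<open>A\<close> or \<open>B\<close> is null: \<open>E\<close>
    still contains a translate of the other set.\<close>
  have *: "sqrt (measure lborel S) \<le> sqrt (measure lborel E)"
    if S: "S \<in> sets borel" and x: "\<And>y. y \<in> S \<Longrightarrow> x + y \<in> E" for S x
  proof -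
    have "S \<subseteq> (+) x -` E" using x by auto
    moreover have "(+) x -` E \<in> sets borel"
      using measurable_sets[of "(+) x" borel borel E] meas by simp
    ultimately have "emeasure lborel S \<le> emeasure lborel ((+) x -` E)"
      by (intro emeasure_mono) auto
    then have "emeasure lborel S \<le> emeasure lborel E"
      by (simp add: emeasure_lborel_vimage_plus meas)
    then show ?thesis using fin by (simp add: measure_def enn2real_mono)
  qed
  consider "measure lborel A = 0" | "measure lborel B = 0"
    | "measure lborel A > 0" "measure lborel B > 0"
    by (metis less_eq_real_def measure_nonneg)
  then show ?thesis
  proof cases
    case 1
    obtain x where "x \<in> A" using ne by auto
    then show ?thesis using *[OF meas(2), of x] sum 1 by auto
  next
    case 2
    obtain y where "y \<in> B" using ne by auto
    then show ?thesis using *[OF meas(1), of y] sum[of _ y] 2 by (auto simp: add.commute)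
  next
    case 3
    let ?f = "\<lambda>(x, y). Complex x y"
    obtain c where c: "c > 0"
      "\<And>S. S \<in> sets borel \<Longrightarrow> emeasure lborel (?f ` S) = ennreal c * emeasure lborel S"
      using linear_bij_emeasure_lborel[OF linear_Complex bij_Complex] by metis
    have cont: "continuous_on UNIV ?f"
      using linear_Complex linear_continuous_on linear_conv_bounded_linear by blast
    then have pre: "?f -` S \<in> sets borel" if "S \<in> sets borel" for S
      using measurable_sets[of ?f borel borel S] that borel_measurable_continuous_onI[OF cont] by simp
    have im: "?f ` (?f -` S) = S" for S
      using bij_Complex by (simp add: bij_def surj_image_vimage_eq)
    have em: "emeasure lborel S = ennreal c * emeasure lborel (?f -` S)" if "S \<in> sets borel" for S
      using c(2)[OF pre[OF that]] unfolding im .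
    have m: "measure lborel S = c * measure lborel (?f -` S)" if "S \<in> sets borel" for S
      using em[OF that] c(1) by (intro measure_eq_scale) auto
    have bpre: "bounded (?f -` S)" if S: "bounded S" for S
    proof -
      obtain r where r: "\<And>z. z \<in> S \<Longrightarrow> norm z \<le> r"
        using S by (auto simp: bounded_iff)
      have "norm p \<le> r" if "p \<in> ?f -` S" for p
        using r[of "?f p"] that by (auto simp: norm_prod_def cmod_def split: prod.splits)
      then show ?thesis unfolding bounded_iff by blast
    qed
    have "sqrt (measure lborel (?f -` A)) + sqrt (measure lborel (?f -` B)) \<le> sqrt (measure lborel (?f -` E))"
    proof (rule brunn_minkowski_real_prod)
      show "emeasure lborel (?f -` E) < \<infinity>"
        using em[OF meas(3)] fin c(1) by (auto simp: ennreal_mult_less_top less_top top_unique)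
      show "measure lborel (?f -` A) > 0" "measure lborel (?f -` B) > 0"
        using 3 c(1) by (auto simp: m meas zero_less_mult_iff)
      show "x + y \<in> ?f -` E" if "x \<in> ?f -` A" "y \<in> ?f -` B" for x y
        using sum[of "?f x" "?f y"] that linear_add[OF linear_Complex, of x y] by simp
    qed (use pre bpre meas bd in blast)+
    from mult_left_mono[OF this, of "sqrt c"] show ?thesis
      using c(1) by (simp add: m meas real_sqrt_mult distrib_left)
  qed
qed

text \<open>Multiplication by \<open>z \<noteq> 0\<close> is a linear bijection, and its scaling
  constant is found from the unit disc, whose image is the disc of radius \<open>cmod z\<close>. For
  \<open>z = 0\<close> the image has at most one point.\<close>

lemma measure_complex_scale:
  assumes [measurable]: "S \<in> sets borel"
  shows "measure lborel ((*) (z::complex) ` S) = (cmod z)\<^sup>2 * measure lborel S"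
proof (cases "z = 0")
  case True
  then have "(*) z ` S \<subseteq> {0}" by auto
  then have "(*) z ` S = {} \<or> (*) z ` S = {0}" by auto
  then show ?thesis using True by (auto simp: measure_def)
next
  case False
  have "bij ((*) z)"
    by (rule bij_betw_byWitness[where f' = "\<lambda>w. w / z"]) (use False in auto)
  moreover have "linear ((*) z)"
    by (rule linearI) (auto simp: algebra_simps)
  ultimately obtain c where c: "c > 0"
      "\<And>S. S \<in> sets borel \<Longrightarrow> emeasure lborel ((*) z ` S) = ennreal c * emeasure lborel S"
    using linear_bij_emeasure_lborel by metis
  have m: "measure lborel ((*) z ` S) = c * measure lborel S" if "S \<in> sets borel" for S
    using c(2)[OF that] c(1) by (intro measure_eq_scale) auto
  have "(*) z ` cball 0 1 = cball (0::complex) (cmod z)"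
  proof (intro set_eqI iffI)
    fix w :: complex assume "w \<in> cball 0 (cmod z)"
    then have "w = z * (w / z)" "w / z \<in> cball 0 1"
      using False by (auto simp: norm_divide field_simps)
    then show "w \<in> (*) z ` cball 0 1" by blast
  qed (auto simp: norm_mult mult_left_le)
  then have "measure lborel (cball (0::complex) (cmod z)) = c * measure lborel (cball (0::complex) 1)"
    using m[of "cball 0 1"] by simp
  then have "(cmod z)\<^sup>2 * unit_ball_vol 2 = c * unit_ball_vol 2"
    by (simp add: content_cball mult.commute)
  then have "c = (cmod z)\<^sup>2"
    by (simp add: unit_ball_vol_2)
  then show ?thesis using m assms by simp
qed

lemma sumset_Suc:
  fixes C :: "nat \<Rightarrow> 'a::comm_monoid_add set"
  shows "{\<Sum>l = 1..Suc n. c l | c. \<forall>l\<in>{1..Suc n}. c l \<in> C l} =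
    {x + y | x y. x \<in> {\<Sum>l = 1..n. c l | c. \<forall>l\<in>{1..n}. c l \<in> C l} \<and> y \<in> C (Suc n)}" (is "?L = ?R")
proof
  show "?L \<subseteq> ?R"
  proof
    fix z assume "z \<in> ?L"
    then obtain c where c: "z = (\<Sum>l = 1..Suc n. c l)" "\<forall>l\<in>{1..Suc n}. c l \<in> C l" by blast
    then have "z = (\<Sum>l = 1..n. c l) + c (Suc n)" by simp
    moreover have "\<forall>l\<in>{1..n}. c l \<in> C l" "c (Suc n) \<in> C (Suc n)" using c by auto
    ultimately show "z \<in> ?R" by blast
  qed
  show "?R \<subseteq> ?L"
  proof
    fix z assume "z \<in> ?R"
    then obtain c y where z: "z = (\<Sum>l = 1..n. c l) + y" "y \<in> C (Suc n)" "\<forall>l\<in>{1..n}. c l \<in> C l"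
      by auto
    have "z = (\<Sum>l = 1..Suc n. (c(Suc n := y)) l)"
      using z by simp
    moreover have "\<forall>l\<in>{1..Suc n}. (c(Suc n := y)) l \<in> C l"
      using z by auto
    ultimately show "z \<in> ?L" by blast
  qed
qed

lemma compact_sumset:
  fixes C :: "nat \<Rightarrow> 'a::real_normed_vector set"
  assumes "\<And>l. l \<in> {1..n} \<Longrightarrow> compact (C l)"
  shows "compact {\<Sum>l = 1..n. c l | c. \<forall>l\<in>{1..n}. c l \<in> C l}"
  using assms
proof (induction n)
  case (Suc n)
  then show ?case unfolding sumset_Suc by (intro compact_sums) auto
qed auto

text \<open>Summands are added one at a time; compactness keeps every partial sum measurable and of
  finite area.\<close>

lemma brunn_minkowski_complex_sumset:
  fixes C :: "nat \<Rightarrow> complex set"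
  assumes "\<And>l. l \<in> {1..n} \<Longrightarrow> compact (C l)" "\<And>l. l \<in> {1..n} \<Longrightarrow> C l \<noteq> {}"
  shows "(\<Sum>l = 1..n. sqrt (measure lborel (C l)))
    \<le> sqrt (measure lborel {\<Sum>l = 1..n. c l | c. \<forall>l\<in>{1..n}. c l \<in> C l})"
  using assms
proof (induction n)
  case (Suc n)
  let ?S = "\<lambda>n. {\<Sum>l = 1..n. c l | c. \<forall>l\<in>{1..n}. c l \<in> C l}"
  have cS: "compact (?S n)" "compact (?S (Suc n))"
    using Suc.prems by (intro compact_sumset; simp)+
  have "\<forall>l\<in>{1..n}. \<exists>x. x \<in> C l"
    using Suc.prems(2) by force
  then obtain c where "\<forall>l\<in>{1..n}. c l \<in> C l"
    by metis
  then have "?S n \<noteq> {}" by blast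
  moreover have "x + y \<in> ?S (Suc n)" if "x \<in> ?S n" "y \<in> C (Suc n)" for x y
    unfolding sumset_Suc using that by blast
  ultimately have "sqrt (measure lborel (?S n)) + sqrt (measure lborel (C (Suc n)))
      \<le> sqrt (measure lborel (?S (Suc n)))"
    using cS Suc.prems emeasure_bounded_finite[of "?S (Suc n)"]
    by (intro brunn_minkowski_complex) (auto simp: borel_compact compact_imp_bounded)
  moreover have "(\<Sum>l = 1..n. sqrt (measure lborel (C l))) \<le> sqrt (measure lborel (?S n))"
    using Suc by auto
  ultimately show ?case by simp
qed auto

text \<open>Inner regularity gives a closed subset missing less than
  \<open>measure lborel S - m\<close>, compact since \<open>S\<close> is bounded. It serves to pass
  from Borel sets to sets whose sumsets are compact, hence measurable.\<close>

lemma inner_compact_measure: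
  fixes S :: "'a::euclidean_space set"
  assumes "S \<in> sets borel" "bounded S" "ennreal m < emeasure lborel S" "m \<ge> 0"
  obtains K where "compact K" "K \<subseteq> S" "m < measure lborel K"
proof -
  have fin: "emeasure lborel S = ennreal (measure lborel S)"
    using emeasure_bounded_finite[OF assms(2)] by (intro emeasure_eq_ennreal_measure) auto
  have lt: "m < measure lborel S"
    using assms(3,4) unfolding fin by (simp add: ennreal_less_iff)
  have "S \<in> sets lebesgue" using assms(1) by simp
  then obtain K where K: "closed K" "K \<subseteq> S" "emeasure lebesgue (S - K) < ennreal (measure lborel S - m)"
    by (rule sets_lebesgue_inner_closed[of S "measure lborel S - m"]) (use lt in simp_all)
  have cK: "compact K"
    using K(1) bounded_subset[OF assms(2) K(2)] by (simp add: compact_eq_bounded_closed)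
  have [simp]: "emeasure lborel K = ennreal (measure lborel K)"
    using emeasure_bounded_finite[OF compact_imp_bounded[OF cK]] by (intro emeasure_eq_ennreal_measure) auto
  have "emeasure lborel S = emeasure lborel K + emeasure lborel (S - K)"
    using K(1,2) assms(1) by (subst plus_emeasure) (auto intro!: arg_cong[where f = "emeasure lborel"])
  also have "\<dots> < ennreal (measure lborel K) + ennreal (measure lborel S - m)"
    using K(3) assms(1) K(1) by (simp add: ennreal_add_left_cancel_less)
  finally have "measure lborel S < measure lborel K + (measure lborel S - m)"
    using lt unfolding fin by (simp add: ennreal_plus[symmetric] ennreal_less_iff del: ennreal_plus)
  then show thesis using that[OF cK K(2)] by simp
qed

text \<open>The estimate for a single fibre. Compact subsets \<open>K l\<close> of area above
  \<open>m\<close> are scaled by \<open>lam l\<close>, which multiplies the root of the area by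
  \<open>cmod (lam l)\<close>, and Brunn-Minkowski adds these roots. In one complex coordinate the
  sets \<open>B l\<close> may differ from each other.\<close>

lemma complex_linear_sumset_emeasure:
  fixes B :: "nat \<Rightarrow> complex set"
  assumes B: "\<And>l. l \<in> {1..k} \<Longrightarrow> B l \<in> sets borel" "\<And>l. l \<in> {1..k} \<Longrightarrow> bounded (B l)"
      "\<And>l. l \<in> {1..k} \<Longrightarrow> ennreal m < emeasure lborel (B l)"
    and "m \<ge> 0" and E: "E \<in> sets borel"
    and sum: "\<And>b. (\<And>l. l \<in> {1..k} \<Longrightarrow> b l \<in> B l) \<Longrightarrow> (\<Sum>l = 1..k. lam l * b l) \<in> E"
  shows "ennreal ((\<Sum>l = 1..k. cmod (lam l))\<^sup>2 * m) \<le> emeasure lborel E"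
proof -
  have "\<exists>K. compact K \<and> K \<subseteq> B l \<and> m < measure lborel K" if "l \<in> {1..k}" for l
    using inner_compact_measure[OF B(1)[OF that] B(2)[OF that] B(3)[OF that] \<open>m \<ge> 0\<close>] by metis
  then obtain K where K: "\<And>l. l \<in> {1..k} \<Longrightarrow> compact (K l) \<and> K l \<subseteq> B l \<and> m < measure lborel (K l)"
    by metis
  let ?C = "\<lambda>l. (*) (lam l) ` K l"
  let ?S = "{\<Sum>l = 1..k. c l | c. \<forall>l\<in>{1..k}. c l \<in> ?C l}"
  have cC: "compact (?C l)" if "l \<in> {1..k}" for l
    using K[OF that] by (intro compact_continuous_image) (auto intro!: continuous_intros)
  have nC: "?C l \<noteq> {}" if "l \<in> {1..k}" for l
    using K[OF that] \<open>m \<ge> 0\<close> by auto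
  have "(\<Sum>l = 1..k. cmod (lam l)) * sqrt m \<le> (\<Sum>l = 1..k. sqrt (measure lborel (?C l)))"
    unfolding sum_distrib_right
  proof (rule sum_mono)
    fix l assume "l \<in> {1..k}"
    then show "cmod (lam l) * sqrt m \<le> sqrt (measure lborel (?C l))"
      using K[of l] by (simp add: measure_complex_scale borel_compact real_sqrt_mult mult_left_mono)
  qed
  also have "\<dots> \<le> sqrt (measure lborel ?S)"
    using cC nC by (rule brunn_minkowski_complex_sumset)
  finally have "((\<Sum>l = 1..k. cmod (lam l)) * sqrt m)\<^sup>2 \<le> (sqrt (measure lborel ?S))\<^sup>2"
    using \<open>m \<ge> 0\<close> by (intro power_mono) (auto intro!: mult_nonneg_nonneg sum_nonneg)
  then have "(\<Sum>l = 1..k. cmod (lam l))\<^sup>2 * m \<le> measure lborel ?S"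
    using \<open>m \<ge> 0\<close> by (simp add: power_mult_distrib)
  then have "ennreal ((\<Sum>l = 1..k. cmod (lam l))\<^sup>2 * m) \<le> ennreal (measure lborel ?S)"
    by (rule ennreal_leI)
  \<comment> \<open>\<open>measure\<close> is 0 by default on a set of infinite measure, so this
    direction holds without a finiteness argument.\<close>
  also have "\<dots> \<le> emeasure lborel ?S"
    by (simp add: measure_def ennreal_enn2real_if)
  also have "\<dots> \<le> emeasure lborel E"
  proof (intro emeasure_mono)
    show "?S \<subseteq> E"
    proof
      fix z assume "z \<in> ?S"
      then obtain c where c: "z = (\<Sum>l = 1..k. c l)" "\<forall>l\<in>{1..k}. c l \<in> ?C l" by auto
      then have "\<forall>l\<in>{1..k}. \<exists>b. b \<in> K l \<and> c l = lam l * b" by blast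
      then obtain b where b: "\<And>l. l \<in> {1..k} \<Longrightarrow> b l \<in> K l \<and> c l = lam l * b l" by metis
      then have "z = (\<Sum>l = 1..k. lam l * b l)" using c by simp
      moreover have "(\<Sum>l = 1..k. lam l * b l) \<in> E"
        using b K by (intro sum) blast
      ultimately show "z \<in> E" by simp
    qed
  qed (use E in auto)
  finally show ?thesis .
qed

section \<open>Sumsets of diagonal images\<close>

text \<open>Integrating the bounds over \<open>t\<close> by the layer cake formula. This turns an
  induction hypothesis about superlevel sets into a comparison of integrals.\<close>

lemma nn_integral_mono_level_sets:
  assumes M: "sigma_finite_measure M" and [measurable]: "f \<in> borel_measurable M" "g \<in> borel_measurable M"
    and le: "\<And>t. t \<ge> 0 \<Longrightarrow> c * emeasure M {x\<in>space M. ennreal t < f x} \<le> emeasure M {x\<in>space M. ennreal t < g x}"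
  shows "c * (\<integral>\<^sup>+x. f x \<partial>M) \<le> (\<integral>\<^sup>+x. g x \<partial>M)"
proof -
  interpret M: sigma_finite_measure M by fact
  have "(\<lambda>t::real. emeasure M {x \<in> space M. ennreal t < f x}) \<in> borel_measurable borel"
    by (rule M.measurable_emeasure) measurable
  then have "c * (\<integral>\<^sup>+x. f x \<partial>M) =
      (\<integral>\<^sup>+t. c * (indicator {0..} t * emeasure M {x\<in>space M. ennreal t < f x}) \<partial>lborel)"
    unfolding nn_integral_level_sets[OF M assms(2)] by (intro nn_integral_cmult[symmetric]) simp
  also have "\<dots> \<le> (\<integral>\<^sup>+t. indicator {0..} t * emeasure M {x\<in>space M. ennreal t < g x} \<partial>lborel)"
    using le by (intro nn_integral_mono) (auto simp: indicator_def)
  also have "\<dots> = (\<integral>\<^sup>+x. g x \<partial>M)"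
    by (rule nn_integral_level_sets[OF M assms(3), symmetric])
  finally show ?thesis .
qed

text \<open>Provides slack: the fibre estimate yields only a non-strict bound at level
  \<open>s\<close>, and \<open>s > t\<close> makes it strict at level \<open>t\<close>, as
  membership in a superlevel set requires.\<close>

lemma ex_real_less_finite_family:
  fixes f :: "'a \<Rightarrow> ennreal"
  assumes "finite I" "I \<noteq> {}" "\<And>i. i \<in> I \<Longrightarrow> ennreal t < f i" "t \<ge> 0"
  obtains s where "s > t" "\<And>i. i \<in> I \<Longrightarrow> ennreal s < f i"
proof -
  have "ennreal t < Min (f ` I)"
    using assms by (subst Min_gr_iff) auto
  then obtain s where s: "ennreal t < s" "s < Min (f ` I)"
    using dense by blast
  then obtain r where r: "s = ennreal r" "r \<ge> 0"
    by (cases s) auto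
  show thesis
  proof (rule that[of r])
    show "t < r" using s(1) r assms(4) by (simp add: ennreal_less_iff)
    show "ennreal r < f i" if "i \<in> I" for i
      using s(2) that assms(1) r by (auto intro: less_le_trans)
  qed
qed

text \<open>The set \<open>E\<close> only has to contain the sumset: this avoids the question whether the sumset is
  measurable. All summands must come from the same \<open>B\<close>: with different sets of equal measure the
  bound fails already for two coordinates.\<close>

lemma PiM_diagonal_sumset_emeasure:
  fixes lam :: "nat \<Rightarrow> 'i \<Rightarrow> complex"
  defines "M \<equiv> \<lambda>I. Pi\<^sub>M I (\<lambda>_::'i. lborel :: complex measure)"
  assumes "finite I" "B \<in> sets (M I)" "E \<in> sets (M I)"
    and "\<And>b i. b \<in> B \<Longrightarrow> i \<in> I \<Longrightarrow> cmod (b i) \<le> R"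
    and "\<And>b. (\<And>l. l \<in> {1..k} \<Longrightarrow> b l \<in> B) \<Longrightarrow> (\<lambda>i\<in>I. \<Sum>l = 1..k. lam l i * b l i) \<in> E"
  shows "ennreal (\<Prod>i\<in>I. (\<Sum>l = 1..k. cmod (lam l i))\<^sup>2) * emeasure (M I) B \<le> emeasure (M I) E"
  using assms(2-)
proof (induction I arbitrary: B E rule: finite_induct)
  case empty
  show ?case
  proof (cases "B = {}")
    case False
    then obtain b where "b \<in> B" by blast
    \<comment> \<open>Over the empty index set the product space has a single point and the constant
      is the empty product 1.\<close>
    have sp: "B \<subseteq> {\<lambda>_. undefined}"
      using sets.sets_into_space[OF empty(1)] by (simp add: M_def space_PiM)
    then have "B \<subseteq> E" using empty(4)[of "\<lambda>_. b"] \<open>b \<in> B\<close> by (auto simp: restrict_def)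
    then show ?thesis using empty(2) by (simp add: emeasure_mono)
  qed auto
next
  case (insert j I)
  interpret P: product_sigma_finite "\<lambda>_::'i. lborel :: complex measure" ..
  have sigI: "sigma_finite_measure (M I)"
    unfolding M_def by (rule P.sigma_finite) (use insert in auto)
  define sl where "sl S y = (\<lambda>z. y(j := z)) -` S" for S :: "('i \<Rightarrow> complex) set" and y
  have sl_sets: "sl S y \<in> sets borel" if "S \<in> sets (M (insert j I))" "y \<in> space (M I)" for S y
  proof -
    have "(\<lambda>z. y(j := z)) \<in> lborel \<rightarrow>\<^sub>M M (insert j I)"
      unfolding M_def using that(2) insert(2)
      by (intro measurable_component_update) (simp_all add: M_def)
    from measurable_sets[OF this that(1)] show ?thesis
      by (simp add: sl_def)
  qed
  define f where "f S y = emeasure lborel (sl S y)" for S y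
  have f_alt: "(\<integral>\<^sup>+z. indicator S (y(j := z)) \<partial>lborel) = f S y"
    if "S \<in> sets (M (insert j I))" "y \<in> space (M I)" for S y
  proof -
    have "(\<integral>\<^sup>+z. indicator S (y(j := z)) \<partial>lborel) = (\<integral>\<^sup>+z. indicator (sl S y) z \<partial>lborel)"
      by (simp add: sl_def indicator_def)
    then show ?thesis using sl_sets[OF that] by (simp add: f_def)
  qed
  have f_meas: "f S \<in> borel_measurable (M I)" if S: "S \<in> sets (M (insert j I))" for S
  proof -
    have "(\<lambda>(y, z). y(j := z)) \<in> M I \<Otimes>\<^sub>M lborel \<rightarrow>\<^sub>M M (insert j I)"
      unfolding M_def by (rule measurable_add_dim)
    then have "(\<lambda>p. indicator S ((\<lambda>(y, z). y(j := z)) p) :: ennreal) \<in> borel_measurable (M I \<Otimes>\<^sub>M lborel)"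
      by (rule measurable_compose[OF _ borel_measurable_indicator[OF S]])
    then have "(\<lambda>y. \<integral>\<^sup>+z. indicator S (y(j := z)) \<partial>lborel) \<in> borel_measurable (M I)"
      by (intro lborel.borel_measurable_nn_integral) (simp add: case_prod_unfold)
    then show ?thesis
      by (rule measurable_cong[THEN iffD1, rotated]) (use f_alt[OF S] in simp)
  qed
  have f_int: "emeasure (M (insert j I)) S = (\<integral>\<^sup>+y. f S y \<partial>M I)" if S: "S \<in> sets (M (insert j I))" for S
  proof -
    have "emeasure (M (insert j I)) S = (\<integral>\<^sup>+x. indicator S x \<partial>M (insert j I))"
      using S by simp
    also have "\<dots> = (\<integral>\<^sup>+y. (\<integral>\<^sup>+z. indicator S (y(j := z)) \<partial>lborel) \<partial>M I)"
      unfolding M_def using S insert(1,2)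
      by (intro P.product_nn_integral_insert) (auto simp: M_def)
    also have "\<dots> = (\<integral>\<^sup>+y. f S y \<partial>M I)"
      by (intro nn_integral_cong f_alt S)
    finally show ?thesis .
  qed
  define r where "r = (\<Sum>l = 1..k. cmod (lam l j))"
  define c where "c = (\<Prod>i\<in>I. (\<Sum>l = 1..k. cmod (lam l i))\<^sup>2)"
  have prod: "(\<Prod>i\<in>insert j I. (\<Sum>l = 1..k. cmod (lam l i))\<^sup>2) = r\<^sup>2 * c"
    using insert(1,2) by (simp add: r_def c_def)
  have "c \<ge> 0" by (simp add: c_def prod_nonneg)
  show ?case
  proof (cases "r = 0")
    case True
    then show ?thesis unfolding prod by simp
  next
    case False
    then have "r > 0"
      by (metis less_eq_real_def norm_ge_zero r_def sum_nonneg)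
    then have "{1..k} \<noteq> {}"
      unfolding r_def by (metis less_irrefl sum.empty)
    have B: "B \<in> sets (M (insert j I))" and E: "E \<in> sets (M (insert j I))"
      using insert.prems by auto
    note [measurable] = f_meas[OF B] f_meas[OF E]
    \<comment> \<open>The weight \<open>1 / r\<^sup>2\<close> compensates the factor
      \<open>r\<^sup>2\<close> gained in coordinate \<open>j\<close>, so that \<open>B\<close> and
      \<open>E\<close> are compared at the same level \<open>t\<close>.\<close>
    have "ennreal c * (\<integral>\<^sup>+y. f B y \<partial>M I) \<le> (\<integral>\<^sup>+y. ennreal (1 / r\<^sup>2) * f E y \<partial>M I)"
    proof (rule nn_integral_mono_level_sets[OF sigI])
      fix t :: real assume "t \<ge> 0"
      let ?B = "{y \<in> space (M I). ennreal t < f B y}"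
      let ?E = "{y \<in> space (M I). ennreal t < ennreal (1 / r\<^sup>2) * f E y}"
      \<comment> \<open>The superlevel sets take the places of \<open>B\<close> and \<open>E\<close>
        in the induction hypothesis; the \<open>k\<close> summands then all come from the one set
        \<open>?B\<close>, while the fibres over them may differ.\<close>
      show "ennreal c * emeasure (M I) ?B \<le> emeasure (M I) ?E"
        unfolding c_def
      proof (rule insert.IH)
        show "?B \<in> sets (M I)" "?E \<in> sets (M I)" by measurable
        show "cmod (b i) \<le> R" if b: "b \<in> ?B" and "i \<in> I" for b i
        proof -
          have "sl B b \<noteq> {}" using b by (auto simp: f_def)
          then obtain z where "b(j := z) \<in> B" by (auto simp: sl_def)
          then have "cmod ((b(j := z)) i) \<le> R" using insert.prems(3) \<open>i \<in> I\<close> by blast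
          then show ?thesis using \<open>i \<in> I\<close> insert(2) by (auto split: if_splits)
        qed
        fix b assume b: "\<And>l. l \<in> {1..k} \<Longrightarrow> b l \<in> ?B"
        let ?w = "\<lambda>i\<in>I. \<Sum>l = 1..k. lam l i * b l i"
        have w: "?w \<in> space (M I)" by (simp add: M_def space_PiM)
        obtain s where s: "s > t" "\<And>l. l \<in> {1..k} \<Longrightarrow> ennreal s < f B (b l)"
          by (rule ex_real_less_finite_family[of "{1..k}" t "\<lambda>l. f B (b l)"])
             (use b \<open>t \<ge> 0\<close> \<open>{1..k} \<noteq> {}\<close> in auto)
        have "ennreal (r\<^sup>2 * s) \<le> f E ?w"
          unfolding r_def f_def
        proof (rule complex_linear_sumset_emeasure)
          fix l assume l: "l \<in> {1..k}"
          show "sl B (b l) \<in> sets borel" using b[OF l] by (intro sl_sets B) auto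
          have "cmod z \<le> R" if "z \<in> sl B (b l)" for z
          proof -
            have "cmod (((b l)(j := z)) j) \<le> R"
              by (rule insert.prems(3)) (use that in \<open>simp_all only: sl_def vimage_eq insertI1\<close>)
            then show ?thesis by simp
          qed
          then show "bounded (sl B (b l))" unfolding bounded_iff by blast
          show "ennreal s < emeasure lborel (sl B (b l))" using s(2)[OF l] by (simp add: f_def)
        next
          show "s \<ge> 0" using s \<open>t \<ge> 0\<close> by simp
          show "sl E ?w \<in> sets borel" by (rule sl_sets[OF E w])
          fix z assume z: "\<And>l. l \<in> {1..k} \<Longrightarrow> z l \<in> sl B (b l)"
          have "(\<lambda>i\<in>insert j I. \<Sum>l = 1..k. lam l i * ((b l)(j := z l)) i) \<in> E"
            by (rule insert.prems(4)) (use z in \<open>simp only: sl_def vimage_eq\<close>)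
          also have "(\<lambda>i\<in>insert j I. \<Sum>l = 1..k. lam l i * ((b l)(j := z l)) i)
              = ?w(j := \<Sum>l = 1..k. lam l j * z l)"
            using insert(2) by (auto simp: fun_eq_iff restrict_def intro!: sum.cong)
          finally show "(\<Sum>l = 1..k. lam l j * z l) \<in> sl E ?w"
            by (simp only: sl_def vimage_eq)
        qed
        then have "ennreal (1 / r\<^sup>2) * ennreal (r\<^sup>2 * s) \<le> ennreal (1 / r\<^sup>2) * f E ?w"
          by (rule mult_left_mono) simp
        moreover have "ennreal (1 / r\<^sup>2) * ennreal (r\<^sup>2 * s) = ennreal s"
          using \<open>r > 0\<close> s \<open>t \<ge> 0\<close> by (simp add: ennreal_mult[symmetric])
        moreover have "ennreal t < ennreal s"
          using s \<open>t \<ge> 0\<close> by (simp add: ennreal_less_iff)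
        ultimately have "ennreal t < ennreal (1 / r\<^sup>2) * f E ?w" by simp
        then show "?w \<in> ?E" using w by blast
      qed
    qed measurable
    also have "\<dots> = ennreal (1 / r\<^sup>2) * (\<integral>\<^sup>+y. f E y \<partial>M I)"
      by (rule nn_integral_cmult) measurable
    finally have "ennreal c * emeasure (M (insert j I)) B \<le> ennreal (1 / r\<^sup>2) * emeasure (M (insert j I)) E"
      by (simp add: f_int B E)
    then have "ennreal (r\<^sup>2) * (ennreal c * emeasure (M (insert j I)) B)
        \<le> ennreal (r\<^sup>2) * (ennreal (1 / r\<^sup>2) * emeasure (M (insert j I)) E)"
      by (rule mult_left_mono) simp
    also have "\<dots> = emeasure (M (insert j I)) E"
      using \<open>r > 0\<close> by (simp add: mult.assoc[symmetric] ennreal_mult[symmetric])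
    finally show ?thesis
      using \<open>c \<ge> 0\<close> unfolding prod by (simp add: ennreal_mult mult.assoc)
  qed
qed

section \<open>From product measures to complex vectors\<close>

lemma borel_measurable_vec_lambda:
  "vec_lambda \<in> borel_measurable (Pi\<^sub>M UNIV (\<lambda>_::'n::finite. lborel :: 'a::euclidean_space measure))"
  by (subst borel_measurable_euclidean_space) (auto simp: Basis_vec_def inner_axis)

text \<open>\<open>lborel\<close> is determined by its values on boxes. A box of vectors is a
  product of coordinate boxes, and \<open>Basis\<close> is indexed by pairs of a coordinate
  \<open>i\<close> and a basis element \<open>b\<close> through \<open>axis i b\<close>.\<close>

lemma lborel_vec_eq_distr_PiM:
  "(lborel :: ('a::euclidean_space ^ 'n) measure) = distr (Pi\<^sub>M UNIV (\<lambda>_::'n. lborel)) borel vec_lambda"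
proof (rule lborel_eqI)
  interpret P: product_sigma_finite "\<lambda>_::'n. lborel :: 'a measure" ..
  fix l u :: "'a ^ 'n" assume le: "\<And>b. b \<in> Basis \<Longrightarrow> l \<bullet> b \<le> u \<bullet> b"
  have le': "(l $ i) \<bullet> b \<le> (u $ i) \<bullet> b" if "b \<in> Basis" for i b
    using le[of "axis i b"] that by (simp add: inner_axis axis_in_Basis_iff)
  have "vec_lambda -` box l u \<inter> space (Pi\<^sub>M UNIV (\<lambda>_::'n. lborel :: 'a measure))
      = (\<Pi>\<^sub>E i\<in>UNIV. box (l $ i) (u $ i))"
    by (auto simp: mem_box Basis_vec_def inner_axis space_PiM PiE_iff)
  then have "emeasure (distr (Pi\<^sub>M UNIV (\<lambda>_::'n. lborel)) borel vec_lambda) (box l u)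
      = (\<Prod>i\<in>UNIV. emeasure lborel (box (l $ i) (u $ i)))"
    by (simp add: emeasure_distr[OF borel_measurable_vec_lambda] P.emeasure_PiM)
  also have "\<dots> = (\<Prod>i\<in>UNIV. ennreal (\<Prod>b\<in>Basis. (u $ i - l $ i) \<bullet> b))"
    using le' by simp
  also have "\<dots> = ennreal (\<Prod>i\<in>UNIV. \<Prod>b\<in>Basis. (u $ i - l $ i) \<bullet> b)"
    using le' by (intro prod_ennreal prod_nonneg) (auto simp: inner_diff_left)
  also have "(\<Prod>i\<in>UNIV. \<Prod>b\<in>Basis. (u $ i - l $ i) \<bullet> b) = (\<Prod>b\<in>Basis. (u - l) \<bullet> b)"
  proof -
    have "(\<Prod>b\<in>Basis. (u - l) \<bullet> b) = (\<Prod>p\<in>UNIV \<times> Basis. (u - l) \<bullet> (case p of (i, b) \<Rightarrow> axis i b))"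
      by (rule prod.reindex_cong[where l = "\<lambda>(i, b). axis i b"])
         (auto simp: Basis_vec_def inj_on_def axis_eq_axis image_iff nonzero_Basis)
    also have "\<dots> = (\<Prod>i\<in>UNIV. \<Prod>b\<in>Basis. (u $ i - l $ i) \<bullet> b)"
      by (subst prod.cartesian_product) (auto simp: inner_axis intro!: prod.cong)
    finally show ?thesis ..
  qed
  finally show "emeasure (distr (Pi\<^sub>M UNIV (\<lambda>_::'n. lborel)) borel vec_lambda) (box l u)
      = (\<Prod>b\<in>Basis. (u - l) \<bullet> b)" .
qed simp

lemma diag_matrix_vector_mult: "(diag_matrix v *v x) $ i = v i * x $ i"
  by (simp add: diag_matrix_def matrix_vector_mult_def if_distrib if_distribR cong: if_cong)

text \<open>The product bound transported along \<open>vec_lambda\<close>. The square reflects that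
  each complex coordinate is a plane; it disappears again when \<open>B\<close> comes from a set of
  the form \<open>A \<times> A\<close>.\<close>

lemma diagonal_sumset_emeasure:
  fixes lam :: "nat \<Rightarrow> 'n::finite \<Rightarrow> complex" and B E :: "(complex ^ 'n) set"
  assumes meas: "B \<in> sets borel" "E \<in> sets borel" and "bounded B"
    and sum: "\<And>b. (\<And>l. l \<in> {1..k} \<Longrightarrow> b l \<in> B) \<Longrightarrow> (\<Sum>l = 1..k. diag_matrix (lam l) *v b l) \<in> E"
  shows "ennreal ((\<Prod>i\<in>UNIV. \<Sum>l = 1..k. cmod (lam l i))\<^sup>2) * emeasure lborel B \<le> emeasure lborel E"
proof -
  let ?M = "Pi\<^sub>M UNIV (\<lambda>_::'n. lborel :: complex measure)"
  have sets: "vec_lambda -` S \<in> sets ?M" if "S \<in> sets borel" for S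
    using measurable_sets[OF borel_measurable_vec_lambda that] by (simp add: space_PiM)
  have em: "emeasure lborel S = emeasure ?M (vec_lambda -` S)" if "S \<in> sets borel" for S :: "(complex ^ 'n) set"
    unfolding lborel_vec_eq_distr_PiM using that by (simp add: emeasure_distr[OF borel_measurable_vec_lambda] space_PiM)
  obtain R where R: "\<And>b. b \<in> B \<Longrightarrow> norm b \<le> R"
    using \<open>bounded B\<close> by (auto simp: bounded_iff)
  have "ennreal (\<Prod>i\<in>UNIV. (\<Sum>l = 1..k. cmod (lam l i))\<^sup>2) * emeasure ?M (vec_lambda -` B)
      \<le> emeasure ?M (vec_lambda -` E)"
  proof (rule PiM_diagonal_sumset_emeasure)
    show "cmod (b i) \<le> R" if "b \<in> vec_lambda -` B" for b i
      using R[of "vec_lambda b"] Finite_Cartesian_Product.norm_nth_le[of "vec_lambda b" i] that by simp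
    fix b assume b: "\<And>l. l \<in> {1..k} \<Longrightarrow> b l \<in> vec_lambda -` B"
    have "(\<Sum>l = 1..k. diag_matrix (lam l) *v vec_lambda (b l)) \<in> E"
      using b by (intro sum) auto
    also have "(\<Sum>l = 1..k. diag_matrix (lam l) *v vec_lambda (b l))
        = vec_lambda (\<lambda>i\<in>UNIV. \<Sum>l = 1..k. lam l i * b l i)"
      by (simp add: vec_eq_iff diag_matrix_vector_mult)
    finally show "(\<lambda>i\<in>UNIV. \<Sum>l = 1..k. lam l i * b l i) \<in> vec_lambda -` E" by simp
  qed (use meas sets in auto)
  then show ?thesis
    by (simp add: em meas prod_power_distrib)
qed

section \<open>Simultaneously diagonalisable matrices\<close>

lemma diag_matrix_mult_left: "(diag_matrix v ** X) $ i $ j = v i * X $ i $ j"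
  by (simp add: diag_matrix_def matrix_matrix_mult_def if_distrib if_distribR cong: if_cong)

lemma diag_matrix_mult_right: "(X ** diag_matrix v) $ i $ j = X $ i $ j * v j"
  by (simp add: diag_matrix_def matrix_matrix_mult_def if_distrib if_distribR cong: if_cong)

lemma map_matrix_cnj_mult:
  "map_matrix cnj (X ** Y) = map_matrix cnj X ** map_matrix cnj Y"
  by (simp add: vec_eq_iff matrix_matrix_mult_def)

text \<open>The vector \<open>x + i y\<close> of the pair \<open>(x, y)\<close>; a real vector
  \<open>x\<close> enters complex space as \<open>(x, 0)\<close>.\<close>

definition complex_vec :: "(real ^ 'd) \<times> (real ^ 'd) \<Rightarrow> complex ^ 'd"
  where "complex_vec p = (\<chi> i. Complex (fst p $ i) (snd p $ i))"

lemma linear_complex_vec: "linear complex_vec"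
  by (rule linearI) (auto simp: complex_vec_def vec_eq_iff complex_eq_iff)

lemma bij_complex_vec: "bij complex_vec"
  by (rule bij_betw_byWitness[where f' = "\<lambda>z. ((\<chi> i. Re (z $ i)), (\<chi> i. Im (z $ i)))"])
     (auto simp: complex_vec_def vec_eq_iff)

lemma complex_vec_matrix_mult:
  "map_matrix complex_of_real P *v complex_vec (x, y) = complex_vec (P *v x, P *v y)"
  by (auto simp: complex_vec_def vec_eq_iff matrix_vector_mult_def complex_eq_iff)

lemma matrix_inv_cancel:
  fixes S :: "'a::semiring_1 ^ 'n ^ 'n"
  assumes "invertible S"
  shows "S ** matrix_inv S = mat 1" "matrix_inv S ** S = mat 1"
  using someI_ex[of "\<lambda>A'. S ** A' = mat 1 \<and> A' ** S = mat 1"] assms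
  by (auto simp: invertible_def matrix_inv_def)

lemma linear_sumset_eq:
  "linear_sumset k L A = {\<Sum>l = 1..k. c l | c. \<forall>l\<in>{1..k}. c l \<in> (*v) (L l) ` A}" (is "?L = ?R")
proof
  show "?L \<subseteq> ?R" unfolding linear_sumset_def by blast
  show "?R \<subseteq> ?L"
  proof
    fix z assume "z \<in> ?R"
    then obtain c where c: "z = (\<Sum>l = 1..k. c l)" "\<forall>l\<in>{1..k}. \<exists>a. a \<in> A \<and> c l = L l *v a" by blast
    then obtain a where a: "\<forall>l\<in>{1..k}. a l \<in> A \<and> c l = L l *v a l" by metis
    then have "z = (\<Sum>l = 1..k. L l *v a l)" using c(1) by simp
    then show "z \<in> ?L" unfolding linear_sumset_def using a by blast
  qed
qed

lemma compact_linear_image: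
  fixes f :: "'a::euclidean_space \<Rightarrow> 'b::real_normed_vector"
  shows "linear f \<Longrightarrow> compact A \<Longrightarrow> compact (f ` A)"
  by (simp add: compact_continuous_image linear_continuous_on linear_conv_bounded_linear)

lemma compact_linear_sumset: "compact A \<Longrightarrow> compact (linear_sumset k L A)"
  unfolding linear_sumset_eq
  by (intro compact_sumset compact_linear_image) auto

text \<open>Diagonalisation with one factor moved across: the first equation passes to
  eigencoordinates, the second says for diagonal \<open>D\<close> that the columns of
  \<open>S\<close> are eigenvectors.\<close>

lemma conjugate_intertwine:
  fixes S T X D :: "'a::semiring_1 ^ 'n ^ 'n"
  assumes "S ** T = mat 1" "T ** S = mat 1" "T ** X ** S = D"
  shows "T ** X = D ** T" "X ** S = S ** D"
proof -
  have "D ** T = T ** X ** (S ** T)" using assms(3) by (metis matrix_mul_assoc)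
  then show "T ** X = D ** T" using assms(1) by simp
  have "S ** D = (S ** T) ** X ** S" using assms(3) by (metis matrix_mul_assoc)
  then show "X ** S = S ** D" using assms(1) by simp
qed

text \<open>\<open>phi\<close> sends \<open>X \<times> X\<close> to a set of measure
  \<open>c * (measure lebesgue X)\<^sup>2\<close>. The diagonal bound for \<open>X = A\<close> and
  \<open>X = ?K\<close> thus has squares on both sides, \<open>c\<close> cancels, and roots are
  taken. \<open>S\<close> and \<open>T\<close> stay explicit so that the bound can be reused for
  another matrix diagonalised by the same pair.\<close>

lemma linear_sumset_measure_ge:
  fixes L :: "nat \<Rightarrow> real ^ 'd ^ 'd::finite" and S T :: "complex ^ 'd ^ 'd"
  assumes ST: "S ** T = mat 1" "T ** S = mat 1"
    and diag: "\<And>l. l \<in> {1..k} \<Longrightarrow> T ** map_matrix complex_of_real (L l) ** S = diag_matrix (lam l)"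
    and "compact A"
  shows "(\<Prod>i\<in>UNIV. \<Sum>l = 1..k. cmod (lam l i)) * measure lebesgue A
    \<le> measure lebesgue (linear_sumset k L A)"
proof -
  let ?K = "linear_sumset k L A"
  define p where "p = (\<Prod>i\<in>UNIV. \<Sum>l = 1..k. cmod (lam l i))"
  have "p \<ge> 0" by (auto simp: p_def intro!: prod_nonneg sum_nonneg)
  have "compact ?K" using \<open>compact A\<close> by (rule compact_linear_sumset)
  define phi where "phi q = T *v complex_vec q" for q :: "(real ^ 'd) \<times> (real ^ 'd)"
  have lin: "linear phi"
    using linear_compose[OF linear_complex_vec matrix_vector_mul_linear[of T]]
    by (simp add: phi_def[abs_def] o_def)
  have "bij ((*v) T)"
    by (rule bij_betw_byWitness[where f' = "(*v) S"]) (auto simp: matrix_vector_mul_assoc ST)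
  then have "bij phi"
    using bij_comp[OF bij_complex_vec] by (simp add: phi_def[abs_def] o_def)
  obtain c where c: "c > 0" "\<And>E. E \<in> sets borel \<Longrightarrow> phi ` E \<in> sets borel"
      "\<And>E. E \<in> sets borel \<Longrightarrow> emeasure lborel (phi ` E) = ennreal c * emeasure lborel E"
    using linear_bij_emeasure_lborel[OF lin \<open>bij phi\<close>] by metis
  have sq: "emeasure lborel (phi ` (X \<times> X)) = ennreal (c * (measure lebesgue X)\<^sup>2)"
    if "compact X" for X :: "(real ^ 'd) set"
  proof -
    have X: "X \<in> sets borel" using that by (rule borel_compact)
    have "emeasure lborel X = ennreal (measure lebesgue X)"
      using emeasure_bounded_finite[OF compact_imp_bounded[OF that]] X
      by (simp add: emeasure_eq_ennreal_measure measure_completion)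
    moreover have "emeasure lborel (X \<times> X) = emeasure lborel X * emeasure lborel X"
      using lborel.emeasure_pair_measure_Times[of X lborel X] X by (simp add: lborel_prod)
    ultimately show ?thesis
      using c(1) c(3)[of "X \<times> X"] borel_compact[OF compact_Times[OF that that]]
      by (simp add: ennreal_mult[symmetric] power2_eq_square)
  qed
  have "ennreal (p\<^sup>2) * emeasure lborel (phi ` (A \<times> A)) \<le> emeasure lborel (phi ` (?K \<times> ?K))"
    unfolding p_def
  proof (rule diagonal_sumset_emeasure)
    show "phi ` (A \<times> A) \<in> sets borel" "phi ` (?K \<times> ?K) \<in> sets borel"
      by (intro c(2) borel_compact compact_Times \<open>compact A\<close> \<open>compact ?K\<close>)+
    show "bounded (phi ` (A \<times> A))"
      by (intro compact_imp_bounded compact_linear_image compact_Times lin \<open>compact A\<close>)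
    fix b assume "\<And>l. l \<in> {1..k} \<Longrightarrow> b l \<in> phi ` (A \<times> A)"
    then have "\<forall>l\<in>{1..k}. \<exists>x y. x \<in> A \<and> y \<in> A \<and> b l = phi (x, y)" by blast
    then obtain x y where xy: "\<And>l. l \<in> {1..k} \<Longrightarrow> x l \<in> A \<and> y l \<in> A \<and> b l = phi (x l, y l)"
      by metis
    \<comment> \<open>Under \<open>phi\<close>, the diagonal matrix acts as the real matrix
      \<open>L l\<close> on the real and the imaginary part separately.\<close>
    have "(\<Sum>l = 1..k. diag_matrix (lam l) *v b l) = (\<Sum>l = 1..k. phi (L l *v x l, L l *v y l))"
    proof (rule sum.cong)
      fix l assume l: "l \<in> {1..k}"
      have "diag_matrix (lam l) *v b l = (T ** map_matrix complex_of_real (L l)) *v complex_vec (x l, y l)"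
        unfolding conjugate_intertwine(1)[OF ST diag[OF l]] using xy[OF l]
        by (simp add: phi_def matrix_vector_mul_assoc)
      also have "\<dots> = phi (L l *v x l, L l *v y l)"
        by (simp only: phi_def matrix_vector_mul_assoc[symmetric] complex_vec_matrix_mult)
      finally show "diag_matrix (lam l) *v b l = phi (L l *v x l, L l *v y l)" .
    qed simp
    also have "\<dots> = phi (\<Sum>l = 1..k. (L l *v x l, L l *v y l))"
      by (rule linear_sum[OF lin, symmetric])
    also have "(\<Sum>l = 1..k. (L l *v x l, L l *v y l)) = (\<Sum>l = 1..k. L l *v x l, \<Sum>l = 1..k. L l *v y l)"
      by (simp add: sum_prod)
    also have "phi \<dots> \<in> phi ` (?K \<times> ?K)"
      using xy unfolding linear_sumset_def by blast
    finally show "(\<Sum>l = 1..k. diag_matrix (lam l) *v b l) \<in> phi ` (?K \<times> ?K)" .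
  qed
  then have "p\<^sup>2 * (c * (measure lebesgue A)\<^sup>2) \<le> c * (measure lebesgue ?K)\<^sup>2"
    using c(1) by (simp add: sq \<open>compact A\<close> \<open>compact ?K\<close> ennreal_mult[symmetric])
  then have "c * (p * measure lebesgue A)\<^sup>2 \<le> c * (measure lebesgue ?K)\<^sup>2"
    by (simp add: power_mult_distrib mult_ac)
  then have "(p * measure lebesgue A)\<^sup>2 \<le> (measure lebesgue ?K)\<^sup>2"
    using c(1) by simp
  then show ?thesis
    unfolding p_def by (rule power2_le_imp_le) simp
qed

text \<open>The matrix \<open>M = S\<^sup>-\<^sup>1 cnj(S)\<close> intertwines \<open>cnj(D\<^sub>l)\<close> and \<open>D\<^sub>l\<close>, so \<open>M\<close> is supported on pairs
  \<open>(i, j)\<close> with \<open>q i = q j\<close> and commutes with \<open>diag q\<close>; this makes \<open>S diag(q) S\<^sup>-\<^sup>1\<close> invariant under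
  conjugation.\<close>

lemma real_diagonal_conjugate:
  fixes L :: "nat \<Rightarrow> real ^ 'd ^ 'd::finite" and S T :: "complex ^ 'd ^ 'd"
  assumes ST: "S ** T = mat 1" "T ** S = mat 1"
    and diag: "\<And>l. l \<in> J \<Longrightarrow> T ** map_matrix complex_of_real (L l) ** S = diag_matrix (lam l)"
    and q: "\<And>i j. (\<And>l. l \<in> J \<Longrightarrow> lam l i = cnj (lam l j)) \<Longrightarrow> q i = q j"
  obtains P :: "real ^ 'd ^ 'd"
  where "T ** map_matrix complex_of_real P ** S = diag_matrix (\<lambda>i. complex_of_real (q i))"
proof -
  let ?c = "map_matrix cnj" and ?Q = "diag_matrix (\<lambda>i. complex_of_real (q i))"
  define M where "M = T ** ?c S"
  have M_entry: "M $ i $ j * cnj (lam l j) = lam l i * M $ i $ j" if l: "l \<in> J" for i j l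
  proof -
    let ?L = "map_matrix complex_of_real (L l)"
    have "M ** ?c (diag_matrix (lam l)) = T ** ?c (S ** diag_matrix (lam l))"
      by (simp add: M_def map_matrix_cnj_mult matrix_mul_assoc)
    also have "\<dots> = T ** ?c (?L ** S)"
      by (simp add: conjugate_intertwine(2)[OF ST diag[OF l]])
    also have "\<dots> = T ** ?L ** ?c S"
    proof -
      have "?c ?L = ?L" by (simp add: vec_eq_iff)
      then show ?thesis by (simp add: map_matrix_cnj_mult matrix_mul_assoc)
    qed
    also have "\<dots> = diag_matrix (lam l) ** M"
      by (simp add: conjugate_intertwine(1)[OF ST diag[OF l]] M_def matrix_mul_assoc)
    finally have "M ** ?c (diag_matrix (lam l)) = diag_matrix (lam l) ** M" .
    moreover have "?c (diag_matrix (lam l)) = diag_matrix (\<lambda>i. cnj (lam l i))"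
      by (simp add: vec_eq_iff diag_matrix_def)
    ultimately have "(M ** diag_matrix (\<lambda>i. cnj (lam l i))) $ i $ j = (diag_matrix (lam l) ** M) $ i $ j"
      by simp
    then show ?thesis by (simp add: diag_matrix_mult_left diag_matrix_mult_right)
  qed
  have comm: "M ** ?Q = ?Q ** M"
  proof -
    have "M $ i $ j * complex_of_real (q j) = complex_of_real (q i) * M $ i $ j" for i j
    proof (cases "M $ i $ j = 0")
      case False
      then have "lam l i = cnj (lam l j)" if "l \<in> J" for l
        using M_entry[OF that, of i j] by (simp add: mult.commute)
      then show ?thesis using q[of i j] by simp
    qed simp
    then show ?thesis by (simp add: vec_eq_iff diag_matrix_mult_left diag_matrix_mult_right)
  qed
  define R where "R = S ** ?Q ** T"
  have SM: "?c S = S ** M" by (simp add: M_def matrix_mul_assoc ST)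
  have "?c S ** ?c T = ?c (S ** T)" by (simp add: map_matrix_cnj_mult)
  also have "\<dots> = mat 1" by (simp add: ST vec_eq_iff mat_def)
  finally have cST: "?c S ** ?c T = mat 1" .
  have "?c R = ?c S ** ?Q ** ?c T"
  proof -
    have "?c ?Q = ?Q" by (simp add: vec_eq_iff diag_matrix_def)
    then show ?thesis by (simp add: R_def map_matrix_cnj_mult)
  qed
  \<comment> \<open>\<open>?c S\<close> becomes \<open>S ** M\<close>, \<open>M\<close> moves past
    \<open>?Q\<close>, and then it is unfolded again to \<open>T ** ?c S\<close>, which meets
    \<open>?c T\<close>.\<close>
  also have "\<dots> = S ** (M ** ?Q) ** ?c T" by (simp add: SM matrix_mul_assoc)
  also have "\<dots> = S ** ?Q ** T ** (?c S ** ?c T)"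
    unfolding comm by (simp add: M_def matrix_mul_assoc)
  finally have "?c R = R" by (simp add: cST R_def)
  then have "R $ i $ j = complex_of_real (Re (R $ i $ j))" for i j
    by (metis Reals_cnj_iff complex_is_Real_iff nth_map_matrix of_real_Re)
  then have R: "map_matrix complex_of_real (map_matrix Re R) = R"
    by (simp add: vec_eq_iff)
  show thesis
  proof (rule that)
    have "T ** R ** S = (T ** S) ** ?Q ** (T ** S)"
      by (simp only: R_def matrix_mul_assoc)
    then show "T ** map_matrix complex_of_real (map_matrix Re R) ** S = ?Q"
      unfolding R by (simp add: ST)
  qed
qed

section \<open>The extremal set: real points with eigencoordinates in the unit polydisc\<close>

definition real_polydisc :: "complex ^ 'd ^ 'd \<Rightarrow> (real ^ 'd::finite) set"
  where "real_polydisc T = {x. \<forall>i. cmod ((T *v complex_vec (x, 0)) $ i) \<le> 1}"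

lemma linear_complex_vec_fst: "linear (\<lambda>x. complex_vec (x, 0))"
  by (rule linearI) (auto simp: complex_vec_def vec_eq_iff complex_eq_iff)

lemma linear_eigencoord: "linear (\<lambda>x. (T *v complex_vec (x, 0)) $ i)"
proof -
  have "linear ((\<lambda>z. z $ i) \<circ> ((*v) T \<circ> (\<lambda>x. complex_vec (x, 0))))"
    by (rule linear_compose[OF linear_compose[OF linear_complex_vec_fst matrix_vector_mul_linear]])
       (rule linearI, auto)
  then show ?thesis by (simp add: o_def)
qed

lemma continuous_on_norm_eigencoord: "continuous_on UNIV (\<lambda>x. cmod ((T *v complex_vec (x, 0)) $ i))"
  by (intro continuous_on_norm linear_continuous_on) (simp add: linear_eigencoord linear_conv_bounded_linear[symmetric])

text \<open>Boundedness holds because \<open>x\<close> is recovered from its eigencoordinates by the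
  bounded map \<open>S\<close>, and each of them has modulus at most 1.\<close>

lemma compact_real_polydisc:
  fixes S T :: "complex ^ 'd ^ 'd::finite"
  assumes ST: "S ** T = mat 1"
  shows "compact (real_polydisc T)"
proof -
  have "closed (real_polydisc T)"
    unfolding real_polydisc_def
    by (intro closed_Collect_all closed_Collect_le continuous_on_norm_eigencoord continuous_on_const)
  moreover have "bounded (real_polydisc T)"
  proof -
    obtain b where b: "b > 0" "\<And>z. norm (S *v z) \<le> norm z * b"
      using bounded_linear.pos_bounded[of "(*v) S"] matrix_vector_mul_linear[of S]
      by (auto simp: linear_conv_bounded_linear)
    have "norm x \<le> real CARD('d) * b" if x: "x \<in> real_polydisc T" for x
    proof -
      let ?z = "T *v complex_vec (x, 0)"
      have "norm x \<le> norm (complex_vec (x, 0))"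
        by (rule norm_le_componentwise_cart) (simp add: complex_vec_def cmod_def)
      also have "\<dots> = norm (S *v ?z)" by (simp add: matrix_vector_mul_assoc ST)
      also have "\<dots> \<le> norm ?z * b" by (rule b)
      also have "norm ?z \<le> (\<Sum>i\<in>UNIV. norm (?z $ i))"
        unfolding norm_vec_def by (rule L2_set_le_sum) simp
      also have "\<dots> \<le> (\<Sum>i\<in>(UNIV :: 'd set). 1)"
        using x by (intro sum_mono) (simp add: real_polydisc_def)
      finally show ?thesis using b(1) by simp
    qed
    then show ?thesis by (auto simp: bounded_iff)
  qed
  ultimately show ?thesis by (simp add: compact_eq_bounded_closed)
qed

text \<open>Strict inequalities cut out an open subset containing 0, and a nonempty open set is not
  negligible.\<close>

lemma measure_real_polydisc_pos:
  fixes S T :: "complex ^ 'd ^ 'd::finite"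
  assumes ST: "S ** T = mat 1"
  shows "measure lebesgue (real_polydisc T) > 0"
proof -
  let ?U = "{x. \<forall>i. cmod ((T *v complex_vec (x, 0)) $ i) < 1}"
  have "open ?U"
    unfolding Collect_all_eq
    by (intro open_INT ballI finite open_Collect_less continuous_on_norm_eigencoord continuous_on_const)
  moreover have "0 \<in> ?U"
    using linear_0[OF linear_eigencoord, of T] by simp
  ultimately have "\<not> negligible ?U" using open_not_negligible by blast
  moreover have "?U \<subseteq> real_polydisc T"
    by (auto simp: real_polydisc_def less_imp_le)
  ultimately have "\<not> negligible (real_polydisc T)"
    using negligible_subset by blast
  then show ?thesis
    using negligible_iff_measure0[OF lmeasurable_compact[OF compact_real_polydisc[OF ST]]]
    by (simp add: zero_less_measure_iff)
qed

text \<open>Row \<open>i\<close> of \<open>T\<close> is nonzero as \<open>T\<close> is invertible,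
  so its real or its imaginary part is a nonzero real functional, and the set lies in a hyperplane.
  It handles the case of a zero radius.\<close>

lemma negligible_eigencoord_kernel:
  fixes S T :: "complex ^ 'd ^ 'd::finite"
  assumes TS: "T ** S = mat 1"
  shows "negligible {x. (T *v complex_vec (x, 0)) $ i = 0}"
proof -
  have "\<exists>j. T $ i $ j \<noteq> 0"
  proof (rule ccontr)
    assume "\<not> ?thesis"
    then have "(T ** S) $ i $ i = 0" by (simp add: matrix_matrix_mult_def)
    then show False by (simp add: TS mat_def)
  qed
  then obtain j where j: "T $ i $ j \<noteq> 0" ..
  have coord: "(T *v complex_vec (x, 0)) $ i = Complex ((\<chi> j. Re (T $ i $ j)) \<bullet> x) ((\<chi> j. Im (T $ i $ j)) \<bullet> x)" for x
    by (simp add: complex_eq_iff matrix_vector_mult_def complex_vec_def inner_vec_def)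
  have "(\<chi> j. Re (T $ i $ j)) \<noteq> 0 \<or> (\<chi> j. Im (T $ i $ j)) \<noteq> 0"
    using j by (auto simp: vec_eq_iff complex_eq_iff)
  then have "negligible {x. (\<chi> j. Re (T $ i $ j)) \<bullet> x = 0} \<or> negligible {x. (\<chi> j. Im (T $ i $ j)) \<bullet> x = 0}"
    using negligible_hyperplane by blast
  then show ?thesis
    by (rule disjE; elim negligible_subset) (auto simp: coord complex_eq_iff)
qed

lemma eigencoord_diagonalised:
  fixes S T :: "complex ^ 'd ^ 'd::finite"
  assumes "S ** T = mat 1" "T ** S = mat 1"
    and "T ** map_matrix complex_of_real P ** S = diag_matrix v"
  shows "(T *v complex_vec (P *v x, 0)) $ i = v i * (T *v complex_vec (x, 0)) $ i"
proof -
  have "complex_vec (P *v x, 0) = map_matrix complex_of_real P *v complex_vec (x, 0)"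
    by (simp add: complex_vec_matrix_mult)
  then have "T *v complex_vec (P *v x, 0) = diag_matrix v *v (T *v complex_vec (x, 0))"
    using conjugate_intertwine(1)[OF assms] by (simp add: matrix_vector_mul_assoc)
  then show ?thesis by (simp add: diag_matrix_vector_mult)
qed

text \<open>Triangle inequality in one eigencoordinate: \<open>L l\<close> multiplies it by
  \<open>lam l i\<close>, and on the polydisc it has modulus at most 1.\<close>

lemma linear_sumset_real_polydisc_eigencoord:
  fixes L :: "nat \<Rightarrow> real ^ 'd ^ 'd::finite" and S T :: "complex ^ 'd ^ 'd"
  assumes ST: "S ** T = mat 1" "T ** S = mat 1"
    and diag: "\<And>l. l \<in> {1..k} \<Longrightarrow> T ** map_matrix complex_of_real (L l) ** S = diag_matrix (lam l)"
    and x: "x \<in> linear_sumset k L (real_polydisc T)"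
  shows "cmod ((T *v complex_vec (x, 0)) $ i) \<le> (\<Sum>l = 1..k. cmod (lam l i))"
proof -
  obtain a where a: "x = (\<Sum>l = 1..k. L l *v a l)" "\<forall>l\<in>{1..k}. a l \<in> real_polydisc T"
    using x by (auto simp: linear_sumset_def)
  have "(T *v complex_vec (x, 0)) $ i = (\<Sum>l = 1..k. (T *v complex_vec (L l *v a l, 0)) $ i)"
    unfolding a(1) by (rule linear_sum[OF linear_eigencoord])
  also have "cmod \<dots> \<le> (\<Sum>l = 1..k. cmod ((T *v complex_vec (L l *v a l, 0)) $ i))"
    by (rule norm_sum)
  also have "\<dots> \<le> (\<Sum>l = 1..k. cmod (lam l i))"
  proof (rule sum_mono)
    fix l assume l: "l \<in> {1..k}"
    have "cmod ((T *v complex_vec (L l *v a l, 0)) $ i) = cmod (lam l i) * cmod ((T *v complex_vec (a l, 0)) $ i)"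
      using eigencoord_diagonalised[OF ST diag[OF l]] by (simp add: norm_mult)
    also have "\<dots> \<le> cmod (lam l i)"
      using a(2) l by (intro mult_left_le) (auto simp: real_polydisc_def)
    finally show "cmod ((T *v complex_vec (L l *v a l, 0)) $ i) \<le> cmod (lam l i)" .
  qed
  finally show ?thesis .
qed

theorem theorem3p1:
  fixes k :: nat
    and L :: "nat \<Rightarrow> real ^ 'd ^ 'd::finite"
    and lam :: "nat \<Rightarrow> 'd \<Rightarrow> complex"
  assumes "k \<ge> 1"
    and "simultaneously_diagonalisable_into k L lam"
  shows "(\<forall>A :: (real ^ 'd) set. compact A \<longrightarrow>
           measure lebesgue (linear_sumset k L A)
             \<ge> (\<Prod>i\<in>UNIV. \<Sum>l = 1..k. cmod (lam l i)) * measure lebesgue A)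
       \<and> (\<exists>A :: (real ^ 'd) set. compact A \<and> measure lebesgue A > 0 \<and>
           measure lebesgue (linear_sumset k L A)
             = (\<Prod>i\<in>UNIV. \<Sum>l = 1..k. cmod (lam l i)) * measure lebesgue A)"
proof -
  obtain S where "invertible S" and
    D: "\<And>l. l \<in> {1..k} \<Longrightarrow> matrix_inv S ** map_matrix complex_of_real (L l) ** S = diag_matrix (lam l)"
    using assms(2) unfolding simultaneously_diagonalisable_into_def by blast
  define T where "T = matrix_inv S"
  have ST: "S ** T = mat 1" "T ** S = mat 1"
    unfolding T_def using \<open>invertible S\<close> by (rule matrix_inv_cancel)+
  have diag: "T ** map_matrix complex_of_real (L l) ** S = diag_matrix (lam l)" if "l \<in> {1..k}" for l
    using D[OF that] by (simp add: T_def)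
  define r where "r i = (\<Sum>l = 1..k. cmod (lam l i))" for i
  have r0: "r i \<ge> 0" for i by (simp add: r_def sum_nonneg)
  have lower: "(\<Prod>i\<in>UNIV. r i) * measure lebesgue A \<le> measure lebesgue (linear_sumset k L A)"
    if "compact A" for A
    unfolding r_def using linear_sumset_measure_ge[OF ST diag that] by simp
  let ?A = "real_polydisc T"
  let ?K = "linear_sumset k L ?A"
  have cA: "compact ?A" by (rule compact_real_polydisc[OF ST(1)])
  then have cK: "compact ?K" by (rule compact_linear_sumset)
  have K: "cmod ((T *v complex_vec (x, 0)) $ i) \<le> r i" if "x \<in> ?K" for x i
    unfolding r_def using linear_sumset_real_polydisc_eigencoord[OF ST diag that] by simp
  \<comment> \<open>Rescaling by \<open>1 / r i\<close> requires nonzero radii, so a zero radius is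
    treated apart; there both sides are 0.\<close>
  have "measure lebesgue ?K \<le> (\<Prod>i\<in>UNIV. r i) * measure lebesgue ?A"
  proof (cases "\<exists>i. r i = 0")
    case True
    then obtain i where i: "r i = 0" ..
    have "?K \<subseteq> {x. (T *v complex_vec (x, 0)) $ i = 0}"
      using K[of _ i] by (auto simp: i)
    then have "negligible ?K"
      using negligible_eigencoord_kernel[OF ST(2)] negligible_subset by blast
    then show ?thesis
      by (simp add: negligible_imp_measure0 prod_nonneg r0)
  next
    case False
    then have r_pos: "r i > 0" for i using r0[of i] by (metis less_eq_real_def)
    obtain P where P: "T ** map_matrix complex_of_real P ** S = diag_matrix (\<lambda>i. complex_of_real (1 / r i))"
    proof (rule real_diagonal_conjugate[OF ST diag])
      \<comment> \<open>Conjugate eigenvalues have equal modulus, so the radii at conjugate indices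
        agree; this is what makes \<open>P\<close> real.\<close>
      fix i j assume "\<And>l. l \<in> {1..k} \<Longrightarrow> lam l i = cnj (lam l j)"
      then show "1 / r i = 1 / r j" by (simp add: r_def)
    qed auto
    \<comment> \<open>The sumset of the single matrix \<open>P\<close> is just the image of
      \<open>?K\<close>. Its measure is at most that of \<open>?A\<close> by this inclusion and at
      least the product of the \<open>1 / r i\<close> times that of \<open>?K\<close> by the lower
      bound; together they bound \<open>?K\<close> from above.\<close>
    have "linear_sumset 1 (\<lambda>_. P) ?K \<subseteq> ?A"
    proof
      fix y assume "y \<in> linear_sumset 1 (\<lambda>_. P) ?K"
      then obtain x where x: "y = P *v x" "x \<in> ?K" by (auto simp: linear_sumset_def)
      have "cmod ((T *v complex_vec (y, 0)) $ i) \<le> 1" for i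
        using K[OF x(2), of i] r_pos[of i] eigencoord_diagonalised[OF ST P, of x i]
        by (simp add: x(1) norm_divide)
      then show "y \<in> ?A" by (simp add: real_polydisc_def)
    qed
    then have "measure lebesgue (linear_sumset 1 (\<lambda>_. P) ?K) \<le> measure lebesgue ?A"
      by (intro measure_mono_fmeasurable lmeasurable_compact cA fmeasurableD compact_linear_sumset cK)
    moreover have "(\<Prod>i\<in>UNIV. \<Sum>l = 1..1::nat. cmod (complex_of_real (1 / r i))) * measure lebesgue ?K
        \<le> measure lebesgue (linear_sumset 1 (\<lambda>_. P) ?K)"
      by (rule linear_sumset_measure_ge[OF ST, where L = "\<lambda>_. P" and k = 1
            and lam = "\<lambda>_ i. complex_of_real (1 / r i)"]) (use P cK in simp_all)
    ultimately have "(\<Prod>i\<in>UNIV. 1 / r i) * measure lebesgue ?K \<le> measure lebesgue ?A"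
      using r_pos by (simp add: norm_divide less_imp_le)
    then show ?thesis
      using r_pos by (simp add: prod_dividef prod_pos pos_divide_le_eq mult.commute)
  qed
  with lower[OF cA] have "measure lebesgue ?K = (\<Prod>i\<in>UNIV. r i) * measure lebesgue ?A"
    by (rule antisym[rotated])
  then show ?thesis
    using lower cA measure_real_polydisc_pos[OF ST(1)] unfolding r_def by blast
qed

end
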